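(* Let $\tau>0$, $A_0\in\mathbb R^{n\times n}$, let $A(\theta)$ be an $n\times n$ matrix of real polynomials in $\theta$, and let $d\ge0$ be an even integer. The solution map of $$\dot x(t)=A_0x(t)+\int_{-\tau}^0A(\theta)x(t+\theta)\,d\theta$$ is asymptotically stable if there exist a constant $\eta>0$, a matrix $P\in\mathbb S^n$ and matrix functions $Q:\mathbb R\to\mathbb R^{n\times n}$, $S:\mathbb R\to\mathbb S^n$, $R:\mathbb R^2\to\mathbb R^{n\times n}$ with $R(\theta,\omega)=R(\omega,\theta)^T$, such that $$\begin{bmatrix}P-\eta I&\tau Q\\ \tau Q^T&\tau S\end{bmatrix}\in G_1^d,\qquad -D\in G_3^d,\qquad R\in G_2^d,\qquad M\in G_2^d,$$ where $$D(\theta)=\begin{bmatrix}D_{11}+\eta I&\tau D_{12}(\theta)\\ \tau D_{12}(\theta)^T&-\tau\dot S(\theta)\end{bmatrix},\qquad D_{11}=\begin{bmatrix}PA_0+A_0^TP+Q(0)+Q(0)^T+S(0)&-Q(-\tau)\\-Q(-\tau)^T&-S(-\tau)\end{bmatrix},$$ $$D_{12}(\theta)=\begin{bmatrix}A_0^TQ(\theta)+PA(\theta)-\frac{d}{d\theta}Q(\theta)+R(0,\theta)\\-R(-\tau,\theta)\end{bmatrix},$$ $$M(\theta,\omega)=\frac{\partial}{\partial\theta}R(\theta,\omega)+\frac{\partial}{\partial\omega}R(\theta,\omega)-A(\theta)^TQ(\omega)-Q(\theta)^TA(\omega).$$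
   Context: $\mathbb S^m$: real symmetric $m\times m$ matrices; $\mathbb S^m[\theta]$: symmetric $m\times m$ matrices of real polynomials in $\theta$; $\mathbb S^m_d[\theta]$: those of degree at most $d$. $G_1^d$ is the set of $N\in\mathbb S^{2n}[\theta]$ for which there is $T\in\mathbb S^n_d[\theta]$ with $\int_{-\tau}^0T(\theta)\,d\theta=0$ and $N(\theta)+\begin{bmatrix}T(\theta)&0\\0&0\end{bmatrix}\ge0$ for all $\theta\in\mathbb R$. $G_3^d$ is the set of $N\in\mathbb S^{3n}[\theta]$ for which there is $T\in\mathbb S^{2n}_d[\theta]$ with $\int_{-\tau}^0T(\theta)\,d\theta=0$ and $N(\theta)+\begin{bmatrix}T(\theta)&0\\0&0\end{bmatrix}\ge0$ for all $\theta\in\mathbb R$. For even $d$, $G_2^{d}$ is the set of kernels $k(\theta,\omega)=\bar Z(\theta)^TQ_0\bar Z(\omega)$, where $\bar Z(\theta)=I_n\otimes(1,\theta,\dots,\theta^{d/2})^T$ and $Q_0\in\mathbb S^{n(d/2+1)}$ is positive semidefinite. $\mathcal C_\tau$ is the space of continuous functions $[-\tau,0]\to\mathbb R^n$ with the supremum norm. The solution map sends $\phi\in\mathcal C_\tau$ to the unique solution on $[-\tau,\infty)$ with $x=\phi$ on $[-\tau,0]$. Asymptotically stable (on $\mathcal C_\tau$; for linear systems this is equivalent to asymptotic stability on any neighborhood of the origin) means: every solution is bounded; for every $\varepsilon>0$ there is $\delta>0$ such that $\|\phi\|<\delta$ implies $\sup_{t\ge-\tau}\|x(t)\|<\varepsilon$;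 and every solution satisfies $\lim_{t\to\infty}x(t)=0$. *)

theory Defs
  imports "HOL-Analysis.Analysis" "HOL-Computational_Algebra.Polynomial"
begin

text \<open>
  The dimension n is the cardinality of the index type \<open>'n\<close>; matrices of sizes 2n and 3n are
  indexed by \<open>'n + 'n\<close> and \<open>('n + 'n) + 'n\<close>.
\<close>

definition pmat :: "real poly^'c^'r \<Rightarrow> real \<Rightarrow> real^'c^'r" where
  "pmat p \<theta> = (\<chi> i j. poly (p $ i $ j) \<theta>)"

definition sym_matrix :: "'a^'m^'m \<Rightarrow> bool" where
  "sym_matrix N \<longleftrightarrow> transpose N = N"

definition psd :: "real^'m^'m \<Rightarrow> bool" where
  "psd N \<longleftrightarrow> sym_matrix N \<and> (\<forall>v. 0 \<le> v \<bullet> (N *v v))"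

definition sym_poly_matrices :: "(real \<Rightarrow> real^'m^'m) set" where
  "sym_poly_matrices = {pmat p | p. sym_matrix p}"

definition sym_poly_matrices_deg :: "nat \<Rightarrow> (real \<Rightarrow> real^'m^'m) set" where
  "sym_poly_matrices_deg d = {pmat p | p. sym_matrix p \<and> (\<forall>i j. degree (p $ i $ j) \<le> d)}"

definition block_matrix ::
    "'a^'c1^'r1 \<Rightarrow> 'a^'c2^'r1 \<Rightarrow> 'a^'c1^'r2 \<Rightarrow> 'a^'c2^'r2 \<Rightarrow> 'a^('c1 + 'c2)^('r1 + 'r2)" where
  "block_matrix A B C E = (\<chi> i j. case i of
      Inl r \<Rightarrow> (case j of Inl c \<Rightarrow> A $ r $ c | Inr c \<Rightarrow> B $ r $ c)
    | Inr r \<Rightarrow> (case j of Inl c \<Rightarrow> C $ r $ c | Inr c \<Rightarrow> E $ r $ c))"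

definition stack_matrix :: "'a^'c^'r1 \<Rightarrow> 'a^'c^'r2 \<Rightarrow> 'a^'c^('r1 + 'r2)" where
  "stack_matrix A B = (\<chi> i j. case i of Inl r \<Rightarrow> A $ r $ j | Inr r \<Rightarrow> B $ r $ j)"

definition G1 :: "real \<Rightarrow> nat \<Rightarrow> (real \<Rightarrow> real^('n::finite + 'n)^('n + 'n)) set" where
  "G1 \<tau> d = {N \<in> sym_poly_matrices.
     \<exists>T \<in> (sym_poly_matrices_deg d :: (real \<Rightarrow> real^'n^'n) set).
       integral {-\<tau>..0} T = 0 \<and> (\<forall>\<theta>. psd (N \<theta> + block_matrix (T \<theta>) 0 0 0))}"

definition G3 :: "real \<Rightarrow> nat \<Rightarrow>
    (real \<Rightarrow> real^(('n::finite + 'n) + 'n)^(('n + 'n) + 'n)) set" where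
  "G3 \<tau> d = {N \<in> sym_poly_matrices.
     \<exists>T \<in> (sym_poly_matrices_deg d :: (real \<Rightarrow> real^('n + 'n)^('n + 'n)) set).
       integral {-\<tau>..0} T = 0 \<and> (\<forall>\<theta>. psd (N \<theta> + block_matrix (T \<theta>) 0 0 0))}"

text \<open>
  The size n (d/2 + 1) depends on the number d, so \<open>Q\<^sub>0\<close> and \<open>Zbar \<theta>\<close> are functions of row and
  column indices. The row of the Kronecker product \<open>I\<^sub>n \<otimes> (1, \<theta>, \<dots>, \<theta>\<^sup>d\<^sup>/\<^sup>2)\<^sup>T\<close> with the
  entries of the i-th copy of the monomial \<open>\<theta>\<^sup>a\<close> has index (i, a).
\<close>

definition Zindex :: "nat \<Rightarrow> ('n::finite \<times> nat) set" where
  "Zindex d = UNIV \<times> {..d div 2}"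

definition Zbar :: "real \<Rightarrow> ('n \<times> nat) \<Rightarrow> 'n \<Rightarrow> real" where
  "Zbar \<theta> p j = (if fst p = j then \<theta> ^ snd p else 0)"

definition psd_on :: "'i set \<Rightarrow> ('i \<Rightarrow> 'i \<Rightarrow> real) \<Rightarrow> bool" where
  "psd_on I Q\<^sub>0 \<longleftrightarrow> (\<forall>p\<in>I. \<forall>q\<in>I. Q\<^sub>0 p q = Q\<^sub>0 q p) \<and>
     (\<forall>v. 0 \<le> (\<Sum>p\<in>I. \<Sum>q\<in>I. v p * Q\<^sub>0 p q * v q))"

definition G2 :: "nat \<Rightarrow> (real \<Rightarrow> real \<Rightarrow> real^'n^'n::finite) set" where
  "G2 d = {k. \<exists>Q\<^sub>0. psd_on (Zindex d) Q\<^sub>0 \<and>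
     (\<forall>\<theta> \<omega>. k \<theta> \<omega> =
       (\<chi> i j. \<Sum>p\<in>Zindex d. \<Sum>q\<in>Zindex d. Zbar \<theta> p i * Q\<^sub>0 p q * Zbar \<omega> q j))}"

text \<open>
  Only the values on \<open>[-\<tau>, 0]\<close> of an element of \<open>C_space \<tau>\<close> matter. Solutions are made unique
  as total functions by requiring them to be \<open>undefined\<close> to the left of \<open>-\<tau>\<close>; the derivative
  at time 0 is the right derivative.
\<close>

definition C_space :: "real \<Rightarrow> (real \<Rightarrow> real^'n) set" where
  "C_space \<tau> = {\<phi>. continuous_on {-\<tau>..0} \<phi>}"

definition C_norm :: "real \<Rightarrow> (real \<Rightarrow> real^'n) \<Rightarrow> real" where
  "C_norm \<tau> \<phi> = (SUP \<theta>\<in>{-\<tau>..0}. norm (\<phi> \<theta>))"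

definition is_solution :: "real \<Rightarrow> real^'n^'n \<Rightarrow> (real \<Rightarrow> real^'n^'n) \<Rightarrow>
    (real \<Rightarrow> real^'n) \<Rightarrow> (real \<Rightarrow> real^'n) \<Rightarrow> bool" where
  "is_solution \<tau> A\<^sub>0 A \<phi> x \<longleftrightarrow>
     x \<in> extensional {-\<tau>..} \<and> continuous_on {-\<tau>..} x \<and> (\<forall>\<theta>\<in>{-\<tau>..0}. x \<theta> = \<phi> \<theta>) \<and>
     (\<forall>t\<ge>0. (x has_vector_derivative
        (A\<^sub>0 *v x t + integral {-\<tau>..0} (\<lambda>\<theta>. A \<theta> *v x (t + \<theta>)))) (at t within {0..}))"

definition solution_map :: "real \<Rightarrow> real^'n^'n \<Rightarrow> (real \<Rightarrow> real^'n^'n) \<Rightarrow>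
    (real \<Rightarrow> real^'n) \<Rightarrow> (real \<Rightarrow> real^'n)" where
  "solution_map \<tau> A\<^sub>0 A \<phi> = (THE x. is_solution \<tau> A\<^sub>0 A \<phi> x)"

definition asymptotically_stable ::
    "real \<Rightarrow> ((real \<Rightarrow> real^'n) \<Rightarrow> (real \<Rightarrow> real^'n)) \<Rightarrow> bool" where
  "asymptotically_stable \<tau> \<Gamma> \<longleftrightarrow>
     (\<forall>\<phi>\<in>C_space \<tau>. bounded (\<Gamma> \<phi> ` {-\<tau>..})) \<and>
     (\<forall>\<epsilon>>0. \<exists>\<delta>>0. \<forall>\<phi>\<in>C_space \<tau>.
        C_norm \<tau> \<phi> < \<delta> \<longrightarrow> (SUP t\<in>{-\<tau>..}. norm (\<Gamma> \<phi> t)) < \<epsilon>) \<and>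
     (\<forall>\<phi>\<in>C_space \<tau>. (\<Gamma> \<phi> \<longlongrightarrow> 0) at_top)"

definition D11 :: "real \<Rightarrow> real^'n^'n \<Rightarrow> real^'n^'n \<Rightarrow> (real \<Rightarrow> real^'n^'n) \<Rightarrow>
    (real \<Rightarrow> real^'n^'n) \<Rightarrow> real^('n::finite + 'n)^('n + 'n)" where
  "D11 \<tau> A\<^sub>0 P Q S = block_matrix
     (P ** A\<^sub>0 + transpose A\<^sub>0 ** P + Q 0 + transpose (Q 0) + S 0)  (- Q (-\<tau>))
     (- transpose (Q (-\<tau>)))                                       (- S (-\<tau>))"

definition D12 :: "real \<Rightarrow> real^'n^'n \<Rightarrow> (real \<Rightarrow> real^'n^'n) \<Rightarrow> real^'n^'n \<Rightarrow>
    (real \<Rightarrow> real^'n^'n) \<Rightarrow> (real \<Rightarrow> real \<Rightarrow> real^'n^'n) \<Rightarrow>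
    real \<Rightarrow> real^'n^('n::finite + 'n)" where
  "D12 \<tau> A\<^sub>0 A P Q R \<theta> = stack_matrix
     (transpose A\<^sub>0 ** Q \<theta> + P ** A \<theta> - vector_derivative Q (at \<theta>) + R 0 \<theta>)
     (- R (-\<tau>) \<theta>)"

definition D_matrix :: "real \<Rightarrow> real \<Rightarrow> real^'n^'n \<Rightarrow> (real \<Rightarrow> real^'n^'n) \<Rightarrow> real^'n^'n \<Rightarrow>
    (real \<Rightarrow> real^'n^'n) \<Rightarrow> (real \<Rightarrow> real^'n^'n) \<Rightarrow> (real \<Rightarrow> real \<Rightarrow> real^'n^'n) \<Rightarrow>
    real \<Rightarrow> real^(('n::finite + 'n) + 'n)^(('n + 'n) + 'n)" where
  "D_matrix \<tau> \<eta> A\<^sub>0 A P Q S R \<theta> = block_matrix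
     (D11 \<tau> A\<^sub>0 P Q S + \<eta> *\<^sub>R mat 1)                (\<tau> *\<^sub>R D12 \<tau> A\<^sub>0 A P Q R \<theta>)
     (\<tau> *\<^sub>R transpose (D12 \<tau> A\<^sub>0 A P Q R \<theta>))     (- (\<tau> *\<^sub>R vector_derivative S (at \<theta>)))"

definition M_kernel :: "(real \<Rightarrow> real^'n^'n) \<Rightarrow> (real \<Rightarrow> real^'n^'n) \<Rightarrow>
    (real \<Rightarrow> real \<Rightarrow> real^'n^'n) \<Rightarrow> real \<Rightarrow> real \<Rightarrow> real^'n^'n::finite" where
  "M_kernel A Q R \<theta> \<omega> =
     vector_derivative (\<lambda>s. R s \<omega>) (at \<theta>) + vector_derivative (\<lambda>s. R \<theta> s) (at \<omega>)
     - transpose (A \<theta>) ** Q \<omega> - transpose (Q \<theta>) ** A \<omega>"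

end

theory Submission
  imports Defs
begin

text \<open>
  The certificate defines a Lyapunov functional on histories \<open>\<psi>\<close>,

  \<open>V(\<psi>) = \<psi>(0)\<^sup>T P \<psi>(0) + 2 \<psi>(0)\<^sup>T \<integral> Q(\<theta>) \<psi>(\<theta>) d\<theta> + \<integral> \<psi>(\<theta>)\<^sup>T S(\<theta>) \<psi>(\<theta>) d\<theta>
      + \<integral>\<integral> \<psi>(\<theta>)\<^sup>T R(\<theta>,\<omega>) \<psi>(\<omega>) d\<omega> d\<theta>\<close>,

  with all integrals over \<open>[-\<tau>, 0]\<close>. The first three terms are at least \<open>\<eta> |\<psi>(0)|\<^sup>2\<close> by the condition in
  \<open>G1\<close>, and the last one is nonnegative because \<open>R\<close> is in \<open>G2\<close> (lemma \<open>lyapunov_lower_bound\<close>).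
  Along a trajectory \<open>x\<close> the derivative of \<open>V\<close> is the mean over \<open>\<theta>\<close> of the quadratic form of
  \<open>D(\<theta>)\<close> at \<open>(x(t), x(t-\<tau>), x(t+\<theta>))\<close>, minus \<open>\<eta> (|x(t)|\<^sup>2 + |x(t-\<tau>)|\<^sup>2)\<close>, minus the double
  integral of \<open>M\<close>. The conditions on \<open>D\<close> and \<open>M\<close> make the mean nonpositive and the double
  integral nonnegative, so the derivative is at most \<open>-\<eta> |x(t)|\<^sup>2\<close> (lemma \<open>lyapunov_derivative\<close>).

  With the upper bound \<open>V(\<psi>) \<le> c sup |\<psi>|\<^sup>2\<close> this gives \<open>|x(t)| \<le> \<gamma> sup |\<phi>|\<close> for the solution with
  initial function \<open>\<phi>\<close>, which is boundedness and stability. It also gives uniqueness: the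
  difference of two solutions has zero initial function. Existence, which is needed for the
  solution map to be meaningful, is a fixed point argument for the integrated equation (lemma
  \<open>dde_solution_exists\<close>). Finally, a bounded solution has a bounded derivative, and a Lipschitz
  function dissipating a nonnegative \<open>V\<close> at the rate \<open>\<eta> |x(t)|\<^sup>2\<close> tends to zero (lemma
  \<open>dissipation_imp_tendsto_zero\<close>).
\<close>

(* Transposes are moved across the inner product by inner_transpose_mult instead. *)
declare transpose_matrix_vector [simp del]

interpretation matvec: bounded_bilinear "(*v) :: real^'c^'r \<Rightarrow> real^'c \<Rightarrow> real^'r"
  unfolding bilinear_conv_bounded_bilinear[symmetric] bilinear_def
  by (auto intro!: linearI simp: matrix_vector_mult_add_rdistrib matrix_vector_right_distrib
      scaleR_matrix_vector_assoc matrix_vector_mult_scaleR)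

lemma inner_transpose_mult:
  "x \<bullet> (transpose B *v y) = (B *v x) \<bullet> y" for B :: "real^'c^'r"
  by (metis dot_lmul_matrix inner_commute transpose_matrix_vector)

section \<open>Block vectors and block matrices\<close>

definition join :: "real^'a \<Rightarrow> real^'b \<Rightarrow> real^('a + 'b)" where
  "join u w = (\<chi> i. case i of Inl a \<Rightarrow> u $ a | Inr b \<Rightarrow> w $ b)"

lemma sum_UNIV_sum:
  "(\<Sum>i\<in>UNIV. f i) = (\<Sum>a\<in>UNIV. f (Inl a)) + (\<Sum>b\<in>UNIV. f (Inr b))"
  for f :: "'a::finite + 'b::finite \<Rightarrow> 'c::comm_monoid_add"
  by (subst UNIV_Plus_UNIV[symmetric], subst sum.Plus) simp_all

lemma inner_join: "join u w \<bullet> join u' w' = u \<bullet> u' + w \<bullet> w'"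
  by (simp add: inner_vec_def join_def sum_UNIV_sum)

lemma block_matrix_mult_join:
  "block_matrix B C D E *v join u w = join (B *v u + C *v w) (D *v u + E *v w)"
  by (auto simp: vec_eq_iff block_matrix_def join_def matrix_vector_mult_def sum_UNIV_sum
      split: sum.splits)

lemma stack_matrix_mult: "stack_matrix B C *v u = join (B *v u) (C *v u)"
  by (auto simp: vec_eq_iff stack_matrix_def join_def matrix_vector_mult_def split: sum.splits)

section \<open>Matrix polynomials and integrals over a moving window\<close>

lemma has_vector_derivative_vec:
  fixes f :: "'i::finite \<Rightarrow> real \<Rightarrow> 'a::euclidean_space"
  assumes "\<And>i. (f i has_vector_derivative f' i) F"
  shows "((\<lambda>t. \<chi> i. f i t) has_vector_derivative (\<chi> i. f' i)) F"
proof -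
  have sum: "(\<chi> i. g i) = (\<Sum>i\<in>UNIV. axis i (g i))" for g :: "'i \<Rightarrow> 'a"
    by (simp add: vec_eq_iff axis_def if_distrib cong: if_cong)
  have lin: "bounded_linear (axis i :: 'a \<Rightarrow> 'a^'i)" for i
    unfolding linear_conv_bounded_linear[symmetric]
    by (rule linearI) (auto simp: vec_eq_iff axis_def)
  show ?thesis
    unfolding sum
    by (rule has_vector_derivative_sum) (rule bounded_linear.has_vector_derivative[OF lin assms])
qed

definition pmat_deriv :: "real poly^'c^'r \<Rightarrow> real poly^'c^'r" where
  "pmat_deriv p = (\<chi> i j. pderiv (p $ i $ j))"

lemma pmat_has_vector_derivative:
  "(pmat p has_vector_derivative pmat (pmat_deriv p) \<theta>) (at \<theta> within U)"
proof -
  have *: "pmat p = (\<lambda>\<theta>. \<chi> i. \<chi> j. poly (p $ i $ j) \<theta>)" for p :: "real poly^'c^'r"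
    by (simp add: pmat_def fun_eq_iff)
  have "((\<lambda>\<theta>. poly q \<theta>) has_vector_derivative poly (pderiv q) \<theta>) (at \<theta> within U)" for q
    unfolding has_real_derivative_iff_has_vector_derivative[symmetric]
    by (rule has_field_derivative_at_within[OF poly_DERIV])
  then show ?thesis
    unfolding * pmat_deriv_def by (simp add: has_vector_derivative_vec)
qed

lemma continuous_on_pmat [continuous_intros]: "continuous_on U (pmat p)"
  by (rule continuous_on_vector_derivative[OF pmat_has_vector_derivative])

lemma integral_has_vector_derivative_ray:
  fixes f :: "real \<Rightarrow> 'a::banach"
  assumes f: "continuous_on {a..} f" and s: "a \<le> s"
  shows "((\<lambda>s. integral {a..s} f) has_vector_derivative f s) (at s within {a..})"
proof -
  have "((\<lambda>s. integral {a..s} f) has_vector_derivative f s) (at s within {a..s+1})"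
    using s by (intro integral_has_vector_derivative continuous_on_subset[OF f]) auto
  moreover have "at s within {a..s+1} = at s within {a..}"
    by (rule at_within_nhd[where S = "{..<s+1}"]) auto
  ultimately show ?thesis by simp
qed

text \<open>
  The history \<open>\<theta> \<mapsto> f (t + \<theta>)\<close> need not be differentiable in \<open>t\<close>, so the derivative cannot be
  taken under the integral. Integration by parts replaces \<open>f\<close> by its primitive, which is
  continuously differentiable and moves the derivative in \<open>\<theta>\<close> to the smooth weight \<open>p\<close>; then
  the Leibniz rule applies. This gives the two boundary terms at the ends of the window.
  The derivative is one-sided at \<open>t = 0\<close>, because \<open>f\<close> is only given on \<open>[-\<tau>, \<infinity>)\<close>.
\<close>

lemma has_vector_derivative_window:
  fixes f :: "real \<Rightarrow> 'b::euclidean_space" and p :: "real \<Rightarrow> 'a::euclidean_space"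
    and p' :: "real \<Rightarrow> 'a"
    and prod :: "'a \<Rightarrow> 'b \<Rightarrow> 'c::euclidean_space"
  assumes bil: "bounded_bilinear prod" and \<tau>: "0 < \<tau>"
    and p: "\<And>\<theta>. (p has_vector_derivative p' \<theta>) (at \<theta> within {-\<tau>..0})"
    and p': "continuous_on {-\<tau>..0} p'"
    and f: "continuous_on {-\<tau>..} f" and t: "0 \<le> t"
  shows "((\<lambda>t. integral {-\<tau>..0} (\<lambda>\<theta>. prod (p \<theta>) (f (t + \<theta>)))) has_vector_derivative
     prod (p 0) (f t) - prod (p (-\<tau>)) (f (t - \<tau>)) -
     integral {-\<tau>..0} (\<lambda>\<theta>. prod (p' \<theta>) (f (t + \<theta>)))) (at t within {0..})"
proof -
  interpret bounded_bilinear prod by fact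
  define \<Phi> where "\<Phi> s = integral {-\<tau>..s} f" for s
  have \<Phi>: "(\<Phi> has_vector_derivative f s) (at s within {-\<tau>..})" if "-\<tau> \<le> s" for s
    unfolding \<Phi>_def by (rule integral_has_vector_derivative_ray[OF f that])
  have \<Phi>_cont: "continuous_on {-\<tau>..} \<Phi>"
    by (rule continuous_on_vector_derivative[OF \<Phi>]) simp
  have p_cont: "continuous_on {-\<tau>..0} p"
    by (rule continuous_on_vector_derivative[OF p])
  have shift: "((\<lambda>s. \<Phi> (s + c)) has_vector_derivative f (s + c)) (at s within {0..})"
    if "-\<tau> \<le> c" "0 \<le> s" for s c
  proof -
    have "(\<Phi> has_vector_derivative f (s + c)) (at (s + c) within (\<lambda>s. s + c) ` {0..})"
      using that by (intro has_vector_derivative_within_subset[OF \<Phi>]) auto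
    then show ?thesis
      using vector_diff_chain_within[of "\<lambda>s. s + c" 1 s "{0..}" \<Phi> "f (s + c)"]
      by (simp add: o_def has_vector_derivative_add_const has_vector_derivative_id)
  qed
  have shift2: "((\<lambda>\<theta>. \<Phi> (s + \<theta>)) has_vector_derivative f (s + \<theta>)) (at \<theta> within {-\<tau>..0})"
    if "-\<tau> \<le> \<theta>" "0 \<le> s" for s \<theta>
  proof -
    have "(\<Phi> has_vector_derivative f (s + \<theta>)) (at (s + \<theta>) within (\<lambda>\<theta>. s + \<theta>) ` {-\<tau>..0})"
      using that by (intro has_vector_derivative_within_subset[OF \<Phi>]) auto
    then show ?thesis
      using vector_diff_chain_within[of "\<lambda>\<theta>. s + \<theta>" 1 \<theta> "{-\<tau>..0}" \<Phi> "f (s + \<theta>)"]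
      by (simp add: o_def add.commute[of s] has_vector_derivative_add_const has_vector_derivative_id)
  qed
  have cont_shift: "continuous_on {-\<tau>..0} (\<lambda>\<theta>. g (s + \<theta>))"
    if "0 \<le> s" "continuous_on {-\<tau>..} g" for s and g :: "real \<Rightarrow> 'b"
    by (rule continuous_on_compose2[OF that(2)]) (use that in \<open>auto intro!: continuous_on_add\<close>)
  \<comment> \<open>Integration by parts with the primitive \<open>\<Phi>\<close> of \<open>f\<close>.\<close>
  have parts: "integral {-\<tau>..0} (\<lambda>\<theta>. prod (p \<theta>) (f (s + \<theta>))) =
      prod (p 0) (\<Phi> (s + 0)) - prod (p (-\<tau>)) (\<Phi> (s + - \<tau>))
      - integral {-\<tau>..0} (\<lambda>\<theta>. prod (p' \<theta>) (\<Phi> (s + \<theta>)))" if "0 \<le> s" for s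
  proof -
    have "((\<lambda>\<theta>. prod (p \<theta>) (f (s + \<theta>)) + prod (p' \<theta>) (\<Phi> (s + \<theta>))) has_integral
        prod (p 0) (\<Phi> (s + 0)) - prod (p (-\<tau>)) (\<Phi> (s + - \<tau>))) {-\<tau>..0}"
      using \<tau> that
      by (intro fundamental_theorem_of_calculus has_vector_derivative p shift2) auto
    moreover have "(\<lambda>\<theta>. prod (p \<theta>) (f (s + \<theta>))) integrable_on {-\<tau>..0}"
      "(\<lambda>\<theta>. prod (p' \<theta>) (\<Phi> (s + \<theta>))) integrable_on {-\<tau>..0}"
      by (intro integrable_continuous_interval continuous_on p_cont p' cont_shift that f \<Phi>_cont)+
    ultimately show ?thesis
      using integral_add[of "\<lambda>\<theta>. prod (p \<theta>) (f (s + \<theta>))" "{-\<tau>..0}" "\<lambda>\<theta>. prod (p' \<theta>) (\<Phi> (s + \<theta>))"]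
      by (simp add: integral_unique eq_diff_eq)
  qed
  have leib: "((\<lambda>s. integral (cbox (-\<tau>) 0) (\<lambda>\<theta>. prod (p' \<theta>) (\<Phi> (s + \<theta>)))) has_vector_derivative
     integral (cbox (-\<tau>) 0) (\<lambda>\<theta>. prod (p' \<theta>) (f (t + \<theta>)))) (at t within {0..})"
  proof (rule leibniz_rule_vector_derivative)
    fix s \<theta> :: real assume "s \<in> {0..}" "\<theta> \<in> cbox (-\<tau>) 0"
    then show "((\<lambda>s. prod (p' \<theta>) (\<Phi> (s + \<theta>))) has_vector_derivative prod (p' \<theta>) (f (s + \<theta>)))
        (at s within {0..})"
      by (intro bounded_linear.has_vector_derivative[OF bounded_linear_right] shift) auto
  next
    fix s :: real assume "s \<in> {0..}"
    then show "(\<lambda>\<theta>. prod (p' \<theta>) (\<Phi> (s + \<theta>))) integrable_on cbox (-\<tau>) 0"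
      using integrable_continuous_interval[OF continuous_on[OF p' cont_shift[OF _ \<Phi>_cont]]] by auto
  next
    have "continuous_on ({0..} \<times> {-\<tau>..0}) (\<lambda>z. prod (p' (snd z)) (f (fst z + snd z)))"
      by (intro continuous_on continuous_on_compose2[OF p'] continuous_on_compose2[OF f])
        (auto intro!: continuous_on_add continuous_on_fst continuous_on_snd)
    then show "continuous_on ({0..} \<times> cbox (-\<tau>) 0) (\<lambda>(s, \<theta>). prod (p' \<theta>) (f (s + \<theta>)))"
      by (simp add: case_prod_unfold)
  qed (use t in auto)
  have "((\<lambda>s. prod (p 0) (\<Phi> (s + 0)) - prod (p (-\<tau>)) (\<Phi> (s + - \<tau>))
      - integral {-\<tau>..0} (\<lambda>\<theta>. prod (p' \<theta>) (\<Phi> (s + \<theta>)))) has_vector_derivative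
     prod (p 0) (f (t + 0)) - prod (p (-\<tau>)) (f (t + - \<tau>)) -
     integral {-\<tau>..0} (\<lambda>\<theta>. prod (p' \<theta>) (f (t + \<theta>)))) (at t within {0..})"
    using leib t \<tau>
    by (intro has_vector_derivative_diff bounded_linear.has_vector_derivative[OF bounded_linear_right] shift)
      auto
  from has_vector_derivative_transform[OF _ parts this] show ?thesis
    using t by simp
qed

section \<open>Kernels in G2\<close>

lemma sum_Zindex: "(\<Sum>p\<in>Zindex d. f p) = (\<Sum>a\<le>d div 2. \<Sum>i\<in>UNIV. f (i, a))"
  for f :: "'n::finite \<times> nat \<Rightarrow> real"
  unfolding Zindex_def by (subst sum.swap) (simp add: sum.cartesian_product)

lemma sum_Zbar: "(\<Sum>p\<in>Zindex d. Zbar \<theta> p i * g p) = (\<Sum>a\<le>d div 2. \<theta> ^ a * g (i, a))"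
  unfolding sum_Zindex Zbar_def by (simp add: if_distrib if_distribR cong: if_cong)

text \<open>
  Grouping the rows and columns of \<open>Q\<^sub>0\<close> by the exponents of the monomials writes the kernel as
  a matrix polynomial with blocks \<open>C a b\<close>. Positivity of \<open>Q\<^sub>0\<close> becomes positivity of the block
  form, where the vector \<open>y a\<close> will be the moment of order \<open>a\<close> of the history.
\<close>

lemma G2_coefficients:
  assumes "k \<in> (G2 d :: (real \<Rightarrow> real \<Rightarrow> real^'n^'n) set)"
  obtains C :: "nat \<Rightarrow> nat \<Rightarrow> real^'n^'n" where
    "\<And>\<theta> \<omega>. k \<theta> \<omega> = (\<Sum>a\<le>d div 2. \<Sum>b\<le>d div 2. (\<theta> ^ a * \<omega> ^ b) *\<^sub>R C a b)"
    "\<And>a b. a \<le> d div 2 \<Longrightarrow> b \<le> d div 2 \<Longrightarrow> transpose (C a b) = C b a"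
    "\<And>y. 0 \<le> (\<Sum>a\<le>d div 2. \<Sum>b\<le>d div 2. y a \<bullet> (C a b *v y b))"
proof -
  obtain Q0 where Q0: "psd_on (Zindex d) Q0" and k: "\<And>\<theta> \<omega>. k \<theta> \<omega> =
       (\<chi> i j. \<Sum>p\<in>Zindex d. \<Sum>q\<in>Zindex d. Zbar \<theta> p i * Q0 p q * Zbar \<omega> q j)"
    using assms by (auto simp: G2_def)
  define C :: "nat \<Rightarrow> nat \<Rightarrow> real^'n^'n" where "C a b = (\<chi> i j. Q0 (i, a) (j, b))" for a b
  show ?thesis
  proof (rule that[of C])
    fix \<theta> \<omega>
    have "(\<Sum>p\<in>Zindex d. \<Sum>q\<in>Zindex d. Zbar \<theta> p i * Q0 p q * Zbar \<omega> q j) =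
        (\<Sum>p\<in>Zindex d. Zbar \<theta> p i * (\<Sum>q\<in>Zindex d. Zbar \<omega> q j * Q0 p q))" for i j
      by (simp add: sum_distrib_left mult_ac)
    also have "\<dots> i j = (\<Sum>a\<le>d div 2. \<Sum>b\<le>d div 2. \<theta> ^ a * \<omega> ^ b * Q0 (i, a) (j, b))" for i j
      unfolding sum_Zbar by (simp add: sum_distrib_left mult.assoc)
    finally show "k \<theta> \<omega> = (\<Sum>a\<le>d div 2. \<Sum>b\<le>d div 2. (\<theta> ^ a * \<omega> ^ b) *\<^sub>R C a b)"
      by (simp add: vec_eq_iff k C_def)
  next
    fix a b assume "a \<le> d div 2" "b \<le> d div 2"
    then show "transpose (C a b) = C b a"
      using Q0 by (auto simp: vec_eq_iff transpose_def C_def psd_on_def Zindex_def)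
  next
    fix y :: "nat \<Rightarrow> real^'n"
    define v where "v p = y (snd p) $ fst p" for p
    have "0 \<le> (\<Sum>p\<in>Zindex d. \<Sum>q\<in>Zindex d. v p * Q0 p q * v q)"
      using Q0 by (simp add: psd_on_def)
    also have "\<dots> = (\<Sum>a\<le>d div 2. \<Sum>i\<in>UNIV. \<Sum>b\<le>d div 2. \<Sum>j\<in>UNIV.
        y a $ i * Q0 (i, a) (j, b) * y b $ j)"
      by (simp add: sum_Zindex v_def)
    also have "\<dots> = (\<Sum>a\<le>d div 2. \<Sum>b\<le>d div 2. \<Sum>i\<in>UNIV. \<Sum>j\<in>UNIV.
        y a $ i * Q0 (i, a) (j, b) * y b $ j)"
      by (intro sum.cong refl sum.swap)
    also have "\<dots> = (\<Sum>a\<le>d div 2. \<Sum>b\<le>d div 2. y a \<bullet> (C a b *v y b))"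
      by (simp add: inner_vec_def matrix_vector_mult_def C_def sum_distrib_left algebra_simps)
    finally show "0 \<le> \<dots>" .
  qed
qed

section \<open>Quadratic forms of separable kernels\<close>

text \<open>
  The value \<open>v\<close> of the double integral \<open>\<integral>\<integral> \<psi>(\<theta>)\<^sup>T K(\<theta>,\<omega>) \<psi>(\<omega>) d\<omega> d\<theta>\<close>. As a relation it
  carries the existence of both integrals along, so that it is additive without side conditions.
\<close>

definition has_kernel_form ::
    "real \<Rightarrow> (real \<Rightarrow> real^'n) \<Rightarrow> (real \<Rightarrow> real \<Rightarrow> real^'n^'n) \<Rightarrow> real \<Rightarrow> bool" where
  "has_kernel_form \<tau> \<psi> K v \<longleftrightarrow> (\<exists>J.
     (\<forall>\<theta>. ((\<lambda>\<omega>. K \<theta> \<omega> *v \<psi> \<omega>) has_integral J \<theta>) {-\<tau>..0}) \<and>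
     ((\<lambda>\<theta>. \<psi> \<theta> \<bullet> J \<theta>) has_integral v) {-\<tau>..0})"

lemma has_kernel_form_unique:
  "has_kernel_form \<tau> \<psi> K v \<Longrightarrow> has_kernel_form \<tau> \<psi> K w \<Longrightarrow> v = w"
  unfolding has_kernel_form_def by (metis (no_types, lifting) ext has_integral_unique)

lemma has_kernel_form_add:
  assumes "has_kernel_form \<tau> \<psi> K v" "has_kernel_form \<tau> \<psi> L w"
  shows "has_kernel_form \<tau> \<psi> (\<lambda>\<theta> \<omega>. K \<theta> \<omega> + L \<theta> \<omega>) (v + w)"
proof -
  obtain J J' where "\<And>\<theta>. ((\<lambda>\<omega>. K \<theta> \<omega> *v \<psi> \<omega>) has_integral J \<theta>) {-\<tau>..0}"
    "((\<lambda>\<theta>. \<psi> \<theta> \<bullet> J \<theta>) has_integral v) {-\<tau>..0}"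
    "\<And>\<theta>. ((\<lambda>\<omega>. L \<theta> \<omega> *v \<psi> \<omega>) has_integral J' \<theta>) {-\<tau>..0}"
    "((\<lambda>\<theta>. \<psi> \<theta> \<bullet> J' \<theta>) has_integral w) {-\<tau>..0}"
    using assms unfolding has_kernel_form_def by blast
  then show ?thesis
    unfolding has_kernel_form_def
    by (intro exI[of _ "\<lambda>\<theta>. J \<theta> + J' \<theta>"])
      (auto simp: matvec.add_left inner_add_right intro: has_integral_add)
qed

lemma has_kernel_form_diff:
  assumes "has_kernel_form \<tau> \<psi> K v" "has_kernel_form \<tau> \<psi> L w"
  shows "has_kernel_form \<tau> \<psi> (\<lambda>\<theta> \<omega>. K \<theta> \<omega> - L \<theta> \<omega>) (v - w)"
proof -
  obtain J J' where "\<And>\<theta>. ((\<lambda>\<omega>. K \<theta> \<omega> *v \<psi> \<omega>) has_integral J \<theta>) {-\<tau>..0}"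
    "((\<lambda>\<theta>. \<psi> \<theta> \<bullet> J \<theta>) has_integral v) {-\<tau>..0}"
    "\<And>\<theta>. ((\<lambda>\<omega>. L \<theta> \<omega> *v \<psi> \<omega>) has_integral J' \<theta>) {-\<tau>..0}"
    "((\<lambda>\<theta>. \<psi> \<theta> \<bullet> J' \<theta>) has_integral w) {-\<tau>..0}"
    using assms unfolding has_kernel_form_def by blast
  then show ?thesis
    unfolding has_kernel_form_def
    by (intro exI[of _ "\<lambda>\<theta>. J \<theta> - J' \<theta>"])
      (auto simp: matvec.diff_left inner_diff_right intro: has_integral_diff)
qed

lemma has_kernel_form_sum:
  assumes "finite I" "\<And>i. i \<in> I \<Longrightarrow> has_kernel_form \<tau> \<psi> (K i) (v i)"
  shows "has_kernel_form \<tau> \<psi> (\<lambda>\<theta> \<omega>. \<Sum>i\<in>I. K i \<theta> \<omega>) (\<Sum>i\<in>I. v i)"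
  using assms
proof (induction I rule: finite_induct)
  case empty
  show ?case
    unfolding has_kernel_form_def by (auto intro!: exI[of _ "\<lambda>_. 0"])
qed (auto intro!: has_kernel_form_add)

lemma has_integral_inner_left:
  assumes "(f has_integral y) U"
  shows "((\<lambda>\<theta>. f \<theta> \<bullet> c) has_integral (y \<bullet> c)) U"
  using has_integral_linear[OF assms bounded_linear_inner_left, of c] by (simp add: o_def)

lemma has_integral_matvec:
  fixes B :: "real^'c^'r"
  assumes "(f has_integral y) U"
  shows "((\<lambda>\<theta>. B *v f \<theta>) has_integral (B *v y)) U"
  using has_integral_linear[OF assms matvec.bounded_linear_right, of B] by (simp add: o_def)

lemma has_kernel_form_separable:
  fixes F G :: "real \<Rightarrow> real^'n^'n"
  assumes "((\<lambda>\<theta>. F \<theta> *v \<psi> \<theta>) has_integral y) {-\<tau>..0}"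
    and "((\<lambda>\<theta>. G \<theta> *v \<psi> \<theta>) has_integral z) {-\<tau>..0}"
  shows "has_kernel_form \<tau> \<psi> (\<lambda>\<theta> \<omega>. transpose (F \<theta>) ** G \<omega>) (y \<bullet> z)"
  unfolding has_kernel_form_def
proof (intro exI conjI allI)
  fix \<theta>
  show "((\<lambda>\<omega>. (transpose (F \<theta>) ** G \<omega>) *v \<psi> \<omega>) has_integral transpose (F \<theta>) *v z) {-\<tau>..0}"
    using has_integral_matvec[OF assms(2)] by (simp add: matrix_vector_mul_assoc)
next
  show "((\<lambda>\<theta>. \<psi> \<theta> \<bullet> (transpose (F \<theta>) *v z)) has_integral (y \<bullet> z)) {-\<tau>..0}"
    using has_integral_inner_left[OF assms(1)] by (simp add: inner_transpose_mult)
qed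

text \<open>
  For a kernel of monomials the double integral splits into moments of \<open>\<psi>\<close>; a kernel in \<open>G2\<close>
  thus acts on \<open>\<psi>\<close> through finitely many vectors.
\<close>

lemma has_kernel_form_scalars:
  fixes C :: "real^'n^'n" and f g :: "real \<Rightarrow> real"
  assumes f: "((\<lambda>\<theta>. f \<theta> *\<^sub>R \<psi> \<theta>) has_integral y) {-\<tau>..0}"
    and g: "((\<lambda>\<theta>. g \<theta> *\<^sub>R \<psi> \<theta>) has_integral z) {-\<tau>..0}"
  shows "has_kernel_form \<tau> \<psi> (\<lambda>\<theta> \<omega>. (f \<theta> * g \<omega>) *\<^sub>R C) (y \<bullet> (C *v z))"
proof -
  have "transpose (f \<theta> *\<^sub>R mat 1) ** (g \<omega> *\<^sub>R C) = (f \<theta> * g \<omega>) *\<^sub>R C" for \<theta> \<omega>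
    by (simp add: matrix_eq matrix_vector_mul_assoc[symmetric] transpose_scalar
        matvec.scaleR_left matvec.scaleR_right)
  moreover have "((\<lambda>\<theta>. (f \<theta> *\<^sub>R mat 1) *v \<psi> \<theta>) has_integral y) {-\<tau>..0}"
    using f by (simp add: matvec.scaleR_left)
  moreover have "((\<lambda>\<theta>. (g \<theta> *\<^sub>R C) *v \<psi> \<theta>) has_integral (C *v z)) {-\<tau>..0}"
    using has_integral_matvec[OF g, of C] by (simp add: matvec.scaleR_left matvec.scaleR_right)
  ultimately show ?thesis
    using has_kernel_form_separable[of "\<lambda>\<theta>. f \<theta> *\<^sub>R mat 1" \<psi> y \<tau> "\<lambda>\<theta>. g \<theta> *\<^sub>R C" "C *v z"]
    by simp
qed

section \<open>The Lyapunov functional\<close>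

text \<open>
  This is why \<open>G1\<close> and \<open>G3\<close> have the multiplier \<open>T\<close>. Pointwise positivity of the matrix is
  tested at the vector with the constant block \<open>v\<close> and the block \<open>\<psi> \<theta>\<close>, and integrated over
  \<open>\<theta>\<close>. Since \<open>v\<close> does not depend on \<open>\<theta>\<close>, the multiplier contributes \<open>v \<bullet> (\<integral>T) v = 0\<close>: it moves
  positivity between different \<open>\<theta>\<close> without changing the integrated form. The factors \<open>\<tau>\<close> in the
  blocks compensate the integral of the constant \<open>v \<bullet> B v\<close>, which is \<open>\<tau>\<close> times that constant.
\<close>

lemma multiplier_integral_nonneg:
  fixes B :: "real^'m^'m" and H :: "real \<Rightarrow> real^'n^'m" and E :: "real \<Rightarrow> real^'n^'n"
    and T :: "real \<Rightarrow> real^'m^'m"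
  assumes \<tau>: "0 < \<tau>"
    and H: "continuous_on {-\<tau>..0} H" and E: "continuous_on {-\<tau>..0} E"
    and T: "T \<in> sym_poly_matrices_deg d" "integral {-\<tau>..0} T = 0"
    and psd: "\<And>\<theta>. psd (block_matrix B (\<tau> *\<^sub>R H \<theta>) (\<tau> *\<^sub>R transpose (H \<theta>)) (\<tau> *\<^sub>R E \<theta>)
                + block_matrix (T \<theta>) 0 0 0)"
    and \<psi>: "continuous_on {-\<tau>..0} \<psi>"
  shows "0 \<le> v \<bullet> (B *v v) + 2 * (v \<bullet> integral {-\<tau>..0} (\<lambda>\<theta>. H \<theta> *v \<psi> \<theta>))
           + integral {-\<tau>..0} (\<lambda>\<theta>. \<psi> \<theta> \<bullet> (E \<theta> *v \<psi> \<theta>))"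
proof -
  have Tc: "continuous_on {-\<tau>..0} T"
    using T(1) continuous_on_pmat by (auto simp: sym_poly_matrices_deg_def)
  have hT: "((\<lambda>\<theta>. v \<bullet> (T \<theta> *v v)) has_integral 0) {-\<tau>..0}"
  proof -
    have "(T has_integral 0) {-\<tau>..0}"
      using integrable_integral[OF integrable_continuous_interval[OF Tc]] T(2) by simp
    moreover have "bounded_linear (\<lambda>X. v \<bullet> (X *v v))"
      by (intro bounded_linear_compose[OF bounded_linear_inner_right matvec.bounded_linear_left])
    ultimately show ?thesis
      using has_integral_linear[of T 0 "{-\<tau>..0}" "\<lambda>X. v \<bullet> (X *v v)"] by (simp add: o_def)
  qed
  have hH: "((\<lambda>\<theta>. v \<bullet> (H \<theta> *v \<psi> \<theta>)) has_integral
      v \<bullet> integral {-\<tau>..0} (\<lambda>\<theta>. H \<theta> *v \<psi> \<theta>)) {-\<tau>..0}"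
    using has_integral_inner_left[OF integrable_integral[OF
        integrable_continuous_interval[OF matvec.continuous_on[OF H \<psi>]]], of v]
    by (simp add: inner_commute)
  have hE: "((\<lambda>\<theta>. \<psi> \<theta> \<bullet> (E \<theta> *v \<psi> \<theta>)) has_integral
      integral {-\<tau>..0} (\<lambda>\<theta>. \<psi> \<theta> \<bullet> (E \<theta> *v \<psi> \<theta>))) {-\<tau>..0}"
    by (intro integrable_integral integrable_continuous_interval continuous_on_inner \<psi>
        matvec.continuous_on E)
  have hB: "((\<lambda>\<theta>. v \<bullet> (B *v v)) has_integral \<tau> * (v \<bullet> (B *v v))) {-\<tau>..0}"
    using has_integral_const_real[of "v \<bullet> (B *v v)" "-\<tau>" 0] \<tau> by simp
  have "0 \<le> v \<bullet> (B *v v) + v \<bullet> (T \<theta> *v v) + \<tau> * (2 * (v \<bullet> (H \<theta> *v \<psi> \<theta>)))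
        + \<tau> * (\<psi> \<theta> \<bullet> (E \<theta> *v \<psi> \<theta>))" for \<theta>
  proof -
    let ?z = "join v (\<psi> \<theta>)"
    have "0 \<le> ?z \<bullet> ((block_matrix B (\<tau> *\<^sub>R H \<theta>) (\<tau> *\<^sub>R transpose (H \<theta>)) (\<tau> *\<^sub>R E \<theta>)
                + block_matrix (T \<theta>) 0 0 0) *v ?z)"
      using psd by (simp add: psd_def)
    then show ?thesis
      by (simp add: matvec.add_left block_matrix_mult_join inner_join inner_add_right
          matvec.scaleR_left inner_transpose_mult inner_commute algebra_simps)
  qed
  from has_integral_nonneg[OF has_integral_add[OF has_integral_add[OF has_integral_add[OF hB hT]
        has_integral_mult_right[OF has_integral_mult_right[OF hH, of 2], of \<tau>]]
        has_integral_mult_right[OF hE, of \<tau>]]] this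
  have "0 \<le> \<tau> * (v \<bullet> (B *v v) + 2 * (v \<bullet> integral {-\<tau>..0} (\<lambda>\<theta>. H \<theta> *v \<psi> \<theta>))
           + integral {-\<tau>..0} (\<lambda>\<theta>. \<psi> \<theta> \<bullet> (E \<theta> *v \<psi> \<theta>)))"
    by (simp add: algebra_simps)
  then show ?thesis
    using \<tau> by (simp add: zero_le_mult_iff)
qed

text \<open>
  The complete quadratic Lyapunov-Krasovskii functional. The last sum is the double integral of
  the kernel \<open>R(\<theta>,\<omega>) = \<Sum>\<^sub>a\<^sub>b \<theta>\<^sup>a \<omega>\<^sup>b C\<^sub>a\<^sub>b\<close>, written with the moments of the history \<open>\<psi>\<close>: in
  this form it is a polynomial in finitely many functions whose derivatives along a trajectory
  are known.
\<close>

definition lyapunov :: "real \<Rightarrow> real^'n^'n \<Rightarrow> (real \<Rightarrow> real^'n^'n) \<Rightarrow> (real \<Rightarrow> real^'n^'n) \<Rightarrow>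
    nat \<Rightarrow> (nat \<Rightarrow> nat \<Rightarrow> real^'n^'n) \<Rightarrow> (real \<Rightarrow> real^'n) \<Rightarrow> real" where
  "lyapunov \<tau> P Q S m C \<psi> =
     \<psi> 0 \<bullet> (P *v \<psi> 0) + 2 * (\<psi> 0 \<bullet> integral {-\<tau>..0} (\<lambda>\<theta>. Q \<theta> *v \<psi> \<theta>))
     + integral {-\<tau>..0} (\<lambda>\<theta>. \<psi> \<theta> \<bullet> (S \<theta> *v \<psi> \<theta>))
     + (\<Sum>a\<le>m. \<Sum>b\<le>m. integral {-\<tau>..0} (\<lambda>\<theta>. \<theta> ^ a *\<^sub>R \<psi> \<theta>) \<bullet>
          (C a b *v integral {-\<tau>..0} (\<lambda>\<theta>. \<theta> ^ b *\<^sub>R \<psi> \<theta>)))"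

lemma inner_symmetric_matrix:
  "sym_matrix P \<Longrightarrow> u \<bullet> (P *v w) = w \<bullet> (P *v u)" for P :: "real^'n^'n"
  by (metis inner_commute inner_transpose_mult sym_matrix_def)

lemma lyapunov_lower_bound:
  assumes \<tau>: "0 < \<tau>"
    and G1: "(\<lambda>\<theta>. block_matrix (P - \<eta> *\<^sub>R mat 1) (\<tau> *\<^sub>R Q \<theta>)
                           (\<tau> *\<^sub>R transpose (Q \<theta>)) (\<tau> *\<^sub>R S \<theta>)) \<in> G1 \<tau> d"
    and QS: "continuous_on {-\<tau>..0} Q" "continuous_on {-\<tau>..0} S"
    and C: "\<And>y. 0 \<le> (\<Sum>a\<le>m. \<Sum>b\<le>m. y a \<bullet> (C a b *v y b))"
    and \<psi>: "continuous_on {-\<tau>..0} \<psi>"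
  shows "\<eta> * (\<psi> 0 \<bullet> \<psi> 0) \<le> lyapunov \<tau> P Q S m C \<psi>"
proof -
  obtain T where T: "T \<in> sym_poly_matrices_deg d" "integral {-\<tau>..0} T = 0"
    and psd: "\<And>\<theta>. psd (block_matrix (P - \<eta> *\<^sub>R mat 1) (\<tau> *\<^sub>R Q \<theta>)
                           (\<tau> *\<^sub>R transpose (Q \<theta>)) (\<tau> *\<^sub>R S \<theta>) + block_matrix (T \<theta>) 0 0 0)"
    using G1 unfolding G1_def by blast
  have "0 \<le> \<psi> 0 \<bullet> ((P - \<eta> *\<^sub>R mat 1) *v \<psi> 0)
      + 2 * (\<psi> 0 \<bullet> integral {-\<tau>..0} (\<lambda>\<theta>. Q \<theta> *v \<psi> \<theta>))
      + integral {-\<tau>..0} (\<lambda>\<theta>. \<psi> \<theta> \<bullet> (S \<theta> *v \<psi> \<theta>))"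
    by (rule multiplier_integral_nonneg[OF \<tau> QS T psd \<psi>])
  then show ?thesis
    using C[of "\<lambda>a. integral {-\<tau>..0} (\<lambda>\<theta>. \<theta> ^ a *\<^sub>R \<psi> \<theta>)"]
    by (simp add: lyapunov_def matvec.diff_left matvec.scaleR_left inner_diff_right)
qed

lemma bounded_on_continuous:
  fixes F :: "real \<Rightarrow> 'a::real_normed_vector"
  assumes "continuous_on {-\<tau>..0} F"
  obtains c where "0 \<le> c" "\<And>\<theta>. \<theta> \<in> {-\<tau>..0} \<Longrightarrow> norm (F \<theta>) \<le> c"
proof -
  have "bounded (F ` {-\<tau>..0})"
    by (intro compact_imp_bounded compact_continuous_image assms compact_Icc)
  then obtain c where "\<forall>y\<in>F ` {-\<tau>..0}. norm y \<le> c"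
    by (auto simp: bounded_iff)
  then show ?thesis
    by (intro that[of "\<bar>c\<bar>"]) force+
qed

lemma norm_matvec_le_bound:
  obtains k where "0 \<le> k" "\<And>(B::real^'c^'r) v. norm (B *v v) \<le> norm B * norm v * k"
  using matvec.nonneg_bounded by blast

lemma norm_integral_kernel_le:
  fixes F :: "real \<Rightarrow> real^'c^'r"
  assumes \<tau>: "0 \<le> \<tau>" and F: "continuous_on {-\<tau>..0} F"
  shows "\<exists>c\<ge>0. \<forall>\<psi> K. continuous_on {-\<tau>..0} \<psi> \<longrightarrow> (\<forall>\<theta>\<in>{-\<tau>..0}. norm (\<psi> \<theta>) \<le> K) \<longrightarrow>
       norm (integral {-\<tau>..0} (\<lambda>\<theta>. F \<theta> *v \<psi> \<theta>)) \<le> c * K"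
proof -
  obtain k where k: "0 \<le> k" "\<And>(B::real^'c^'r) v. norm (B *v v) \<le> norm B * norm v * k"
    using norm_matvec_le_bound by blast
  obtain b where b: "0 \<le> b" "\<And>\<theta>. \<theta> \<in> {-\<tau>..0} \<Longrightarrow> norm (F \<theta>) \<le> b"
    using bounded_on_continuous[OF F] by blast
  show ?thesis
  proof (intro exI[of _ "b * k * \<tau>"] conjI allI impI)
    show "0 \<le> b * k * \<tau>" using k b \<tau> by simp
    fix \<psi> :: "real \<Rightarrow> real^'c" and K
    assume \<psi>: "continuous_on {-\<tau>..0} \<psi>" and K: "\<forall>\<theta>\<in>{-\<tau>..0}. norm (\<psi> \<theta>) \<le> K"
    have "norm (F \<theta> *v \<psi> \<theta>) \<le> b * K * k" if "\<theta> \<in> {-\<tau>..0}" for \<theta>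
    proof -
      have "norm (F \<theta> *v \<psi> \<theta>) \<le> norm (F \<theta>) * norm (\<psi> \<theta>) * k" by (rule k)
      also have "\<dots> \<le> b * K * k"
        using b K that k(1) by (intro mult_right_mono mult_mono) auto
      finally show ?thesis .
    qed
    then show "norm (integral {-\<tau>..0} (\<lambda>\<theta>. F \<theta> *v \<psi> \<theta>)) \<le> b * k * \<tau> * K"
      using integral_bound[of "-\<tau>" 0 "\<lambda>\<theta>. F \<theta> *v \<psi> \<theta>" "b * K * k"] \<tau>
        matvec.continuous_on[OF F \<psi>] by (simp add: algebra_simps)
  qed
qed

lemma lyapunov_upper_bound:
  fixes P :: "real^'n^'n"
  assumes \<tau>: "0 < \<tau>" and QS: "continuous_on {-\<tau>..0} Q" "continuous_on {-\<tau>..0} S"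
  obtains c where "0 \<le> c"
    "\<And>\<psi> K. continuous_on {-\<tau>..0} \<psi> \<Longrightarrow> \<forall>\<theta>\<in>{-\<tau>..0}. norm (\<psi> \<theta>) \<le> K \<Longrightarrow>
       lyapunov \<tau> P Q S m C \<psi> \<le> c * K\<^sup>2"
proof -
  obtain k where k: "0 \<le> k" "\<And>(B::real^'n^'n) v. norm (B *v v) \<le> norm B * norm v * k"
    using norm_matvec_le_bound by blast
  have bil: "u \<bullet> (B *v w) \<le> norm u * (norm B * norm w * k)" for u w and B :: "real^'n^'n"
    by (rule order_trans[OF norm_cauchy_schwarz]) (intro mult_left_mono k, simp)
  obtain cQ where cQ: "0 \<le> cQ" "\<And>\<psi> K. continuous_on {-\<tau>..0} \<psi> \<Longrightarrow>
      \<forall>\<theta>\<in>{-\<tau>..0}. norm (\<psi> \<theta>) \<le> K \<Longrightarrow>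
       norm (integral {-\<tau>..0} (\<lambda>\<theta>. Q \<theta> *v \<psi> \<theta>)) \<le> cQ * K"
    using norm_integral_kernel_le[OF less_imp_le[OF \<tau>] QS(1)] by blast
  have "\<exists>c\<ge>0. \<forall>\<psi>::real \<Rightarrow> real^'n. \<forall>K. continuous_on {-\<tau>..0} \<psi> \<longrightarrow>
      (\<forall>\<theta>\<in>{-\<tau>..0}. norm (\<psi> \<theta>) \<le> K) \<longrightarrow>
       norm (integral {-\<tau>..0} (\<lambda>\<theta>. \<theta> ^ a *\<^sub>R \<psi> \<theta>)) \<le> c * K" for a :: nat
  proof -
    have "continuous_on {-\<tau>..0} (\<lambda>\<theta>. \<theta> ^ a *\<^sub>R (mat 1 :: real^'n^'n))"
      by (intro continuous_intros)
    from norm_integral_kernel_le[OF less_imp_le[OF \<tau>] this] show ?thesis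
      by (simp add: matvec.scaleR_left)
  qed
  from choice[OF allI[OF this]]
  obtain cy where cy': "\<forall>a. cy a \<ge> 0 \<and> (\<forall>(\<psi> :: real \<Rightarrow> real^'n) K. continuous_on {-\<tau>..0} \<psi> \<longrightarrow>
      (\<forall>\<theta>\<in>{-\<tau>..0}. norm (\<psi> \<theta>) \<le> K) \<longrightarrow>
       norm (integral {-\<tau>..0} (\<lambda>\<theta>. \<theta> ^ a *\<^sub>R \<psi> \<theta>)) \<le> cy a * K)"
    by (rule exE)
  have cy: "0 \<le> cy a" "continuous_on {-\<tau>..0} \<psi> \<Longrightarrow>
      \<forall>\<theta>\<in>{-\<tau>..0}. norm (\<psi> \<theta> :: real^'n) \<le> K \<Longrightarrow>
       norm (integral {-\<tau>..0} (\<lambda>\<theta>. \<theta> ^ a *\<^sub>R \<psi> \<theta>)) \<le> cy a * K" for a \<psi> K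
    using cy'[rule_format, of a] by auto
  obtain s where s: "0 \<le> s" "\<And>\<theta>. \<theta> \<in> {-\<tau>..0} \<Longrightarrow> norm (S \<theta>) \<le> s"
    using bounded_on_continuous[OF QS(2)] by blast
  define c where "c = norm P * k + 2 * cQ + s * k * \<tau>
      + (\<Sum>a\<le>m. \<Sum>b\<le>m. cy a * (norm (C a b) * cy b * k))"
  show ?thesis
  proof (rule that[of c])
    show "0 \<le> c"
      unfolding c_def using k s cQ cy(1) \<tau>
      by (intro add_nonneg_nonneg sum_nonneg mult_nonneg_nonneg) auto
    fix \<psi> :: "real \<Rightarrow> real^'n" and K
    assume \<psi>: "continuous_on {-\<tau>..0} \<psi>" and "\<forall>\<theta>\<in>{-\<tau>..0}. norm (\<psi> \<theta>) \<le> K"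
    then have K: "norm (\<psi> \<theta>) \<le> K" if "\<theta> \<in> {-\<tau>..0}" for \<theta>
      using that by blast
    have K0: "norm (\<psi> 0) \<le> K" using K[of 0] \<tau> by simp
    then have Kpos: "0 \<le> K" using norm_ge_zero order_trans by blast
    have B: "u \<bullet> (B *v w) \<le> (\<alpha> * (norm B * \<beta> * k)) * K\<^sup>2"
      if "norm u \<le> \<alpha> * K" "norm w \<le> \<beta> * K" "0 \<le> \<alpha>" for u w and B :: "real^'n^'n" and \<alpha> \<beta>
    proof -
      have "norm u * (norm B * norm w * k) \<le> (\<alpha> * K) * (norm B * (\<beta> * K) * k)"
        using that k(1) Kpos by (intro mult_mono mult_right_mono mult_left_mono) auto
      then show ?thesis
        using bil[of u B w] by (simp add: power2_eq_square algebra_simps)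
    qed
    have 1: "\<psi> 0 \<bullet> (P *v \<psi> 0) \<le> (norm P * k) * K\<^sup>2"
      using B[of "\<psi> 0" 1 "\<psi> 0" 1 P] K0 by simp
    have 2: "\<psi> 0 \<bullet> integral {-\<tau>..0} (\<lambda>\<theta>. Q \<theta> *v \<psi> \<theta>) \<le> cQ * K\<^sup>2"
    proof -
      have "norm (\<psi> 0) * norm (integral {-\<tau>..0} (\<lambda>\<theta>. Q \<theta> *v \<psi> \<theta>)) \<le> K * (cQ * K)"
        using K0 cQ(2)[OF \<psi>] K Kpos by (intro mult_mono) auto
      then show ?thesis
        using norm_cauchy_schwarz[of "\<psi> 0" "integral {-\<tau>..0} (\<lambda>\<theta>. Q \<theta> *v \<psi> \<theta>)"]
        by (simp add: power2_eq_square algebra_simps)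
    qed
    have 3: "integral {-\<tau>..0} (\<lambda>\<theta>. \<psi> \<theta> \<bullet> (S \<theta> *v \<psi> \<theta>)) \<le> (s * k * \<tau>) * K\<^sup>2"
    proof -
      have "\<psi> \<theta> \<bullet> (S \<theta> *v \<psi> \<theta>) \<le> s * k * K\<^sup>2" if "\<theta> \<in> {-\<tau>..0}" for \<theta>
      proof -
        have "\<psi> \<theta> \<bullet> (S \<theta> *v \<psi> \<theta>) \<le> (norm (S \<theta>) * k) * K\<^sup>2"
          using B[of "\<psi> \<theta>" 1 "\<psi> \<theta>" 1 "S \<theta>"] K[OF that] by simp
        also have "\<dots> \<le> s * k * K\<^sup>2"
          using s(2)[OF that] k(1) by (intro mult_right_mono) auto
        finally show ?thesis .
      qed
      then have "integral {-\<tau>..0} (\<lambda>\<theta>. \<psi> \<theta> \<bullet> (S \<theta> *v \<psi> \<theta>)) \<le> integral {-\<tau>..0} (\<lambda>\<theta>. s * k * K\<^sup>2)"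
        by (intro integral_le integrable_continuous_interval continuous_on_inner \<psi>
            matvec.continuous_on QS continuous_on_const) auto
      then show ?thesis using \<tau> by (simp add: algebra_simps)
    qed
    have 4: "(\<Sum>a\<le>m. \<Sum>b\<le>m. integral {-\<tau>..0} (\<lambda>\<theta>. \<theta> ^ a *\<^sub>R \<psi> \<theta>) \<bullet>
          (C a b *v integral {-\<tau>..0} (\<lambda>\<theta>. \<theta> ^ b *\<^sub>R \<psi> \<theta>)))
        \<le> (\<Sum>a\<le>m. \<Sum>b\<le>m. cy a * (norm (C a b) * cy b * k)) * K\<^sup>2"
      unfolding sum_distrib_right by (intro sum_mono B cy \<psi> ballI K)
    from 1 2 3 4 show "lyapunov \<tau> P Q S m C \<psi> \<le> c * K\<^sup>2"
      unfolding lyapunov_def c_def by (simp add: distrib_right)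
  qed
qed

lemma has_integral_join:
  fixes f :: "real \<Rightarrow> real^'i::finite" and g :: "real \<Rightarrow> real^'j::finite"
  assumes "(f has_integral a) U" "(g has_integral b) U"
  shows "((\<lambda>\<theta>. join (f \<theta>) (g \<theta>)) has_integral join a b) U"
proof -
  have "bounded_linear (\<lambda>u :: real^'i. join u (0 :: real^'j))"
    "bounded_linear (\<lambda>w :: real^'j. join (0 :: real^'i) w)"
    unfolding linear_conv_bounded_linear[symmetric]
    by (auto intro!: linearI simp: vec_eq_iff join_def split: sum.splits)
  then have "((\<lambda>\<theta>. join (f \<theta>) 0 + join 0 (g \<theta>)) has_integral join a 0 + join 0 b) U"
    using has_integral_linear[OF assms(1)] has_integral_linear[OF assms(2)]
    by (intro has_integral_add) (simp_all add: o_def)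
  moreover have "join u 0 + join 0 w = join u w" for u :: "real^'i" and w :: "real^'j"
    by (auto simp: vec_eq_iff join_def split: sum.splits)
  ultimately show ?thesis by simp
qed

lemma has_integral_separable_kernel:
  fixes C :: "nat \<Rightarrow> nat \<Rightarrow> real^'n^'n"
  assumes y: "\<And>b. ((\<lambda>\<omega>. \<omega> ^ b *\<^sub>R \<psi> \<omega>) has_integral y b) U"
  shows "((\<lambda>\<omega>. (\<Sum>a\<le>m. \<Sum>b\<le>m. (\<theta> ^ a * \<omega> ^ b) *\<^sub>R C a b) *v \<psi> \<omega>) has_integral
     (\<Sum>a\<le>m. \<Sum>b\<le>m. \<theta> ^ a *\<^sub>R (C a b *v y b))) U"
proof -
  have "((\<lambda>\<omega>. \<theta> ^ a *\<^sub>R (C a b *v (\<omega> ^ b *\<^sub>R \<psi> \<omega>))) has_integral \<theta> ^ a *\<^sub>R (C a b *v y b)) U" for a b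
    by (intro has_integral_cmul has_integral_matvec y)
  then have "((\<lambda>\<omega>. \<Sum>a\<le>m. \<Sum>b\<le>m. \<theta> ^ a *\<^sub>R (C a b *v (\<omega> ^ b *\<^sub>R \<psi> \<omega>))) has_integral
     (\<Sum>a\<le>m. \<Sum>b\<le>m. \<theta> ^ a *\<^sub>R (C a b *v y b))) U"
    by (intro has_integral_sum) auto
  then show ?thesis
    by (simp add: matvec.sum_left matvec.scaleR_left matvec.scaleR_right)
qed

lemma uminus_block_matrix:
  "- block_matrix B C D E = block_matrix (- B) (- C) (- D) (- E)"
  by (auto simp: vec_eq_iff block_matrix_def split: sum.splits)

lemma transpose_uminus: "transpose (- B) = - transpose B"
  by (simp add: vec_eq_iff transpose_def)

lemma continuous_on_stack_matrix:
  fixes f :: "real \<Rightarrow> real^'c^'r1" and g :: "real \<Rightarrow> real^'c^'r2"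
  assumes "continuous_on U f" "continuous_on U g"
  shows "continuous_on U (\<lambda>\<theta>. stack_matrix (f \<theta>) (g \<theta>))"
proof -
  have "continuous_on U (\<lambda>\<theta>. case i of Inl r \<Rightarrow> f \<theta> $ r $ j | Inr r \<Rightarrow> g \<theta> $ r $ j)" for i j
    using assms by (cases i) (auto intro!: continuous_on_component)
  then show ?thesis
    unfolding stack_matrix_def by (intro continuous_on_vec_lambda)
qed

text \<open>
  Up to the double integral of \<open>M\<close>, the left-hand side is the derivative of the functional
  along a trajectory with present value \<open>u\<close>, delayed value \<open>w\<close> and history \<open>\<psi>\<close>; the vectors
  \<open>y b\<close> are the moments of \<open>\<psi>\<close>. The matrix \<open>D\<close> is built so that its quadratic form at
  \<open>(u, w, \<psi> \<theta>)\<close> has this expression plus \<open>\<eta> (|u|\<^sup>2 + |w|\<^sup>2)\<close> as its mean over \<open>\<theta>\<close>.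
\<close>

lemma G3_dissipation:
  fixes q s A :: "real poly^'n^'n" and C :: "nat \<Rightarrow> nat \<Rightarrow> real^'n^'n"
  assumes \<tau>: "0 < \<tau>" and \<eta>: "0 \<le> \<eta>"
    and G3: "(\<lambda>\<theta>. - D_matrix \<tau> \<eta> A\<^sub>0 (pmat A) P (pmat q) (pmat s) R \<theta>) \<in> G3 \<tau> d"
    and R: "\<And>\<theta> \<omega>. R \<theta> \<omega> = (\<Sum>a\<le>m. \<Sum>b\<le>m. (\<theta> ^ a * \<omega> ^ b) *\<^sub>R C a b)"
    and P: "sym_matrix P"
    and \<psi>: "continuous_on {-\<tau>..0} \<psi>"
    and y: "\<And>a. ((\<lambda>\<theta>. \<theta> ^ a *\<^sub>R \<psi> \<theta>) has_integral y a) {-\<tau>..0}"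
  shows "2 * ((A\<^sub>0 *v u + integral {-\<tau>..0} (\<lambda>\<theta>. pmat A \<theta> *v \<psi> \<theta>)) \<bullet> (P *v u))
     + 2 * ((A\<^sub>0 *v u) \<bullet> integral {-\<tau>..0} (\<lambda>\<theta>. pmat q \<theta> *v \<psi> \<theta>)
       + u \<bullet> (pmat q 0 *v u - pmat q (-\<tau>) *v w
               - integral {-\<tau>..0} (\<lambda>\<theta>. pmat (pmat_deriv q) \<theta> *v \<psi> \<theta>)))
     + (u \<bullet> (pmat s 0 *v u) - w \<bullet> (pmat s (-\<tau>) *v w)
         - integral {-\<tau>..0} (\<lambda>\<theta>. \<psi> \<theta> \<bullet> (pmat (pmat_deriv s) \<theta> *v \<psi> \<theta>)))
     + 2 * (\<Sum>a\<le>m. \<Sum>b\<le>m. (0 ^ a *\<^sub>R u - (-\<tau>) ^ a *\<^sub>R w) \<bullet> (C a b *v y b))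
     \<le> - \<eta> * (u \<bullet> u)"
proof -
  let ?D11 = "D11 \<tau> A\<^sub>0 P (pmat q) (pmat s)"
  let ?D12 = "\<lambda>\<theta>. D12 \<tau> A\<^sub>0 (pmat A) P (pmat q) R \<theta>"
  let ?iA = "integral {-\<tau>..0} (\<lambda>\<theta>. pmat A \<theta> *v \<psi> \<theta>)"
  let ?iq = "integral {-\<tau>..0} (\<lambda>\<theta>. pmat q \<theta> *v \<psi> \<theta>)"
  let ?iq' = "integral {-\<tau>..0} (\<lambda>\<theta>. pmat (pmat_deriv q) \<theta> *v \<psi> \<theta>)"
  let ?is' = "integral {-\<tau>..0} (\<lambda>\<theta>. \<psi> \<theta> \<bullet> (pmat (pmat_deriv s) \<theta> *v \<psi> \<theta>))"
  let ?\<rho> = "\<lambda>\<theta>. \<Sum>a\<le>m. \<Sum>b\<le>m. \<theta> ^ a *\<^sub>R (C a b *v y b)"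
  obtain T where T: "T \<in> sym_poly_matrices_deg d" "integral {-\<tau>..0} T = 0"
    and psd: "\<And>\<theta>. psd (- D_matrix \<tau> \<eta> A\<^sub>0 (pmat A) P (pmat q) (pmat s) R \<theta> + block_matrix (T \<theta>) 0 0 0)"
    using G3 unfolding G3_def by blast
  have vd: "vector_derivative (pmat p) (at \<theta>) = pmat (pmat_deriv p) \<theta>" for p :: "real poly^'n^'n" and \<theta>
    by (rule vector_derivative_at[OF pmat_has_vector_derivative])
  have h: "((\<lambda>\<theta>. pmat p \<theta> *v \<psi> \<theta>) has_integral integral {-\<tau>..0} (\<lambda>\<theta>. pmat p \<theta> *v \<psi> \<theta>)) {-\<tau>..0}"
    for p :: "real poly^'n^'n"
    by (intro integrable_integral integrable_continuous_interval matvec.continuous_on \<psi> continuous_on_pmat)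
  have hR: "((\<lambda>\<omega>. R \<theta> \<omega> *v \<psi> \<omega>) has_integral ?\<rho> \<theta>) {-\<tau>..0}" for \<theta>
    unfolding R by (rule has_integral_separable_kernel[OF y])
  have D12_cont: "continuous_on {-\<tau>..0} (\<lambda>\<theta>. - ?D12 \<theta>)"
  proof -
    have R_cont: "continuous_on {-\<tau>..0} (\<lambda>\<theta>. R c \<theta>)" for c
      unfolding R by (intro continuous_intros)
    have lin: "bounded_linear (\<lambda>X :: real^'n^'n. B ** X)" for B :: "real^'n^'n"
      unfolding linear_conv_bounded_linear[symmetric]
      by (rule linearI) (simp_all add: matrix_eq matrix_vector_mul_assoc[symmetric]
          matvec.add_left matvec.add_right matvec.scaleR_left matvec.scaleR_right)
    have "continuous_on {-\<tau>..0} (\<lambda>\<theta>. B ** pmat p \<theta>)"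
      for p :: "real poly^'n^'n" and B :: "real^'n^'n"
      by (rule bounded_linear.continuous_on[OF lin continuous_on_pmat])
    then show ?thesis
      unfolding D12_def vd
      by (intro continuous_on_minus continuous_on_stack_matrix continuous_on_add continuous_on_diff
          continuous_on_pmat R_cont)
  qed
  have "- D_matrix \<tau> \<eta> A\<^sub>0 (pmat A) P (pmat q) (pmat s) R \<theta> =
      block_matrix (- (?D11 + \<eta> *\<^sub>R mat 1)) (\<tau> *\<^sub>R (- ?D12 \<theta>)) (\<tau> *\<^sub>R transpose (- ?D12 \<theta>))
        (\<tau> *\<^sub>R pmat (pmat_deriv s) \<theta>)" for \<theta>
    by (simp add: D_matrix_def uminus_block_matrix transpose_uminus vd)
  note psd = psd[unfolded this]
  have D12_int: "((\<lambda>\<theta>. - ?D12 \<theta> *v \<psi> \<theta>) has_integral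
      - join (transpose A\<^sub>0 *v ?iq + P *v ?iA - ?iq' + ?\<rho> 0) (- ?\<rho> (-\<tau>))) {-\<tau>..0}"
  proof -
    have "((\<lambda>\<theta>. - join (transpose A\<^sub>0 *v (pmat q \<theta> *v \<psi> \<theta>) + P *v (pmat A \<theta> *v \<psi> \<theta>)
          - pmat (pmat_deriv q) \<theta> *v \<psi> \<theta> + R 0 \<theta> *v \<psi> \<theta>) (- (R (-\<tau>) \<theta> *v \<psi> \<theta>))) has_integral
      - join (transpose A\<^sub>0 *v ?iq + P *v ?iA - ?iq' + ?\<rho> 0) (- ?\<rho> (-\<tau>))) {-\<tau>..0}"
      by (intro has_integral_neg has_integral_join has_integral_add has_integral_diff
          has_integral_matvec h hR)
    then show ?thesis
      by (simp add: D12_def stack_matrix_mult matvec.minus_left matvec.add_left matvec.diff_left vd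
          matrix_vector_mul_assoc)
  qed
  have "0 \<le> join u w \<bullet> (- (?D11 + \<eta> *\<^sub>R mat 1) *v join u w)
      + 2 * (join u w \<bullet> integral {-\<tau>..0} (\<lambda>\<theta>. - ?D12 \<theta> *v \<psi> \<theta>)) + ?is'"
    by (rule multiplier_integral_nonneg[OF \<tau> D12_cont continuous_on_pmat T psd \<psi>])
  also have "integral {-\<tau>..0} (\<lambda>\<theta>. - ?D12 \<theta> *v \<psi> \<theta>) =
      - join (transpose A\<^sub>0 *v ?iq + P *v ?iA - ?iq' + ?\<rho> 0) (- ?\<rho> (-\<tau>))"
    by (rule integral_unique[OF D12_int])
  also have "join u w \<bullet> (- (?D11 + \<eta> *\<^sub>R mat 1) *v join u w) =
      - (2 * ((A\<^sub>0 *v u) \<bullet> (P *v u)) + 2 * (u \<bullet> (pmat q 0 *v u)) + u \<bullet> (pmat s 0 *v u)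
       - 2 * (u \<bullet> (pmat q (-\<tau>) *v w)) - w \<bullet> (pmat s (-\<tau>) *v w) + \<eta> * (u \<bullet> u) + \<eta> * (w \<bullet> w))"
    by (simp add: D11_def matvec.minus_left matvec.add_left matvec.scaleR_left block_matrix_mult_join
        inner_join inner_add_right inner_transpose_mult matrix_vector_mul_assoc[symmetric]
        inner_symmetric_matrix[OF P, of u] inner_commute algebra_simps)
  finally have main: "0 \<le> - (2 * ((A\<^sub>0 *v u) \<bullet> (P *v u)) + 2 * (u \<bullet> (pmat q 0 *v u)) + u \<bullet> (pmat s 0 *v u)
       - 2 * (u \<bullet> (pmat q (-\<tau>) *v w)) - w \<bullet> (pmat s (-\<tau>) *v w) + \<eta> * (u \<bullet> u) + \<eta> * (w \<bullet> w))
      - 2 * ((A\<^sub>0 *v u) \<bullet> ?iq + ?iA \<bullet> (P *v u) - u \<bullet> ?iq' + u \<bullet> ?\<rho> 0 - w \<bullet> ?\<rho> (-\<tau>)) + ?is'"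
    by (simp add: inner_join inner_add_right inner_diff_right inner_transpose_mult
        inner_symmetric_matrix[OF P, of u] algebra_simps)
  have sum: "(\<Sum>a\<le>m. \<Sum>b\<le>m. (0 ^ a *\<^sub>R u - (-\<tau>) ^ a *\<^sub>R w) \<bullet> (C a b *v y b)) =
      u \<bullet> ?\<rho> 0 - w \<bullet> ?\<rho> (-\<tau>)"
    by (simp add: inner_sum_right inner_diff_left sum_subtractf)
  have "0 \<le> \<eta> * (w \<bullet> w)" using \<eta> by simp
  with main show ?thesis
    unfolding sum by (simp add: inner_add_left inner_diff_right inner_add_right algebra_simps)
qed


lemma has_vector_derivative_matvec:
  fixes B :: "real^'c^'r"
  shows "(f has_vector_derivative f') F \<Longrightarrow> ((\<lambda>t. B *v f t) has_vector_derivative (B *v f')) F"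
  by (rule bounded_linear.has_vector_derivative[OF matvec.bounded_linear_right])

lemma has_derivative_inner_real:
  fixes f g :: "real \<Rightarrow> 'a::real_inner"
  assumes "(f has_vector_derivative f') (at t within U)" "(g has_vector_derivative g') (at t within U)"
  shows "((\<lambda>t. f t \<bullet> g t) has_real_derivative f' \<bullet> g t + f t \<bullet> g') (at t within U)"
  using bounded_bilinear.has_vector_derivative[OF bounded_bilinear_inner assms]
  by (simp add: has_real_derivative_iff_has_vector_derivative add.commute)

lemma inner_outer: "B \<bullet> (\<chi> i j. v $ i * v $ j) = v \<bullet> (B *v v)" for B :: "real^'n^'n"
  by (simp add: inner_vec_def matrix_vector_mult_def sum_distrib_left algebra_simps)

text \<open>
  The terms with \<open>Q\<close>, \<open>S\<close> and \<open>R\<close> contain integrals over a moving window, so each contributes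
  boundary terms and a term with the differentiated weight. In the kernel part the latter produce the double
  integral of \<open>\<partial>\<^sub>\<theta>R + \<partial>\<^sub>\<omega>R\<close>, and twice the product of the distributed delay
  \<open>\<integral>A(\<theta>)x(t+\<theta>)d\<theta>\<close> with \<open>\<integral>Q(\<theta>)x(t+\<theta>)d\<theta>\<close> is a double integral, too. Together they are minus
  the form of \<open>M\<close>, hence not positive; all other terms are those of \<open>D\<close>.
\<close>

lemma lyapunov_derivative:
  fixes q s A :: "real poly^'n^'n" and C :: "nat \<Rightarrow> nat \<Rightarrow> real^'n^'n" and x :: "real \<Rightarrow> real^'n"
  assumes \<tau>: "0 < \<tau>" and \<eta>: "0 \<le> \<eta>"
    and P: "sym_matrix P"
    and G3: "(\<lambda>\<theta>. - D_matrix \<tau> \<eta> A\<^sub>0 (pmat A) P (pmat q) (pmat s) R \<theta>) \<in> G3 \<tau> d"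
    and R: "\<And>\<theta> \<omega>. R \<theta> \<omega> = (\<Sum>a\<le>m. \<Sum>b\<le>m. (\<theta> ^ a * \<omega> ^ b) *\<^sub>R C a b)"
    and C: "\<And>a b. a \<le> m \<Longrightarrow> b \<le> m \<Longrightarrow> transpose (C a b) = C b a"
    and M: "M_kernel (pmat A) (pmat q) R \<in> G2 d"
    and cont: "continuous_on {-\<tau>..} x" and t: "0 \<le> t"
    and x: "(x has_vector_derivative
        (A\<^sub>0 *v x t + integral {-\<tau>..0} (\<lambda>\<theta>. pmat A \<theta> *v x (t + \<theta>)))) (at t within {0..})"
  shows "\<exists>D. ((\<lambda>t. lyapunov \<tau> P (pmat q) (pmat s) m C (\<lambda>\<theta>. x (t + \<theta>))) has_real_derivative D)
           (at t within {0..}) \<and> D \<le> - \<eta> * (x t \<bullet> x t)"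
proof -
  let ?\<psi> = "\<lambda>\<theta>. x (t + \<theta>)"
  define \<alpha> where "\<alpha> = integral {-\<tau>..0} (\<lambda>\<theta>. pmat A \<theta> *v ?\<psi> \<theta>)"
  define iq where "iq t = integral {-\<tau>..0} (\<lambda>\<theta>. pmat q \<theta> *v x (t + \<theta>))" for t
  define iq' where "iq' = pmat q 0 *v x t - pmat q (-\<tau>) *v x (t - \<tau>)
    - integral {-\<tau>..0} (\<lambda>\<theta>. pmat (pmat_deriv q) \<theta> *v ?\<psi> \<theta>)"
  define js where "js t = integral {-\<tau>..0} (\<lambda>\<theta>. x (t + \<theta>) \<bullet> (pmat s \<theta> *v x (t + \<theta>)))" for t
  define js' where "js' = x t \<bullet> (pmat s 0 *v x t) - x (t - \<tau>) \<bullet> (pmat s (-\<tau>) *v x (t - \<tau>))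
    - integral {-\<tau>..0} (\<lambda>\<theta>. ?\<psi> \<theta> \<bullet> (pmat (pmat_deriv s) \<theta> *v ?\<psi> \<theta>))"
  define y where "y a t = integral {-\<tau>..0} (\<lambda>\<theta>. \<theta> ^ a *\<^sub>R x (t + \<theta>))" for a t
  define z where "z a = integral {-\<tau>..0} (\<lambda>\<theta>. (real a * \<theta> ^ (a - 1)) *\<^sub>R ?\<psi> \<theta>)" for a
  define e where "e a = 0 ^ a *\<^sub>R x t - (-\<tau>) ^ a *\<^sub>R x (t - \<tau>)" for a
  let ?x' = "A\<^sub>0 *v x t + \<alpha>"
  note x = x[folded \<alpha>_def]
  have \<psi>: "continuous_on {-\<tau>..0} ?\<psi>"
    by (rule continuous_on_compose2[OF cont]) (use t in \<open>auto intro!: continuous_on_add\<close>)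
  have d_iq: "(iq has_vector_derivative iq') (at t within {0..})"
    unfolding iq_def iq'_def
    by (rule has_vector_derivative_window[OF matvec.bounded_bilinear_axioms \<tau>
        pmat_has_vector_derivative continuous_on_pmat cont t])
  have d_js: "(js has_real_derivative js') (at t within {0..})"
  proof -
    \<comment> \<open>The quadratic term is bilinear in \<open>S\<close> and the outer product of \<open>x\<close> with itself.\<close>
    let ?o = "\<lambda>t. \<chi> i j. x t $ i * x t $ j"
    have "continuous_on {-\<tau>..} ?o"
      by (intro continuous_on_vec_lambda continuous_on_mult continuous_on_component cont)
    from has_vector_derivative_window[OF bounded_bilinear_inner \<tau> pmat_has_vector_derivative[of s]
        continuous_on_pmat this t]
    show ?thesis
      unfolding has_real_derivative_iff_has_vector_derivative js_def js'_def inner_outer .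
  qed
  have d_y: "(y a has_vector_derivative (e a - z a)) (at t within {0..})" for a
  proof -
    have "((\<lambda>\<theta>. \<theta> ^ a) has_vector_derivative real a * \<theta> ^ (a - 1)) (at \<theta> within {-\<tau>..0})" for \<theta> :: real
      unfolding has_real_derivative_iff_has_vector_derivative[symmetric]
      by (rule has_field_derivative_at_within) (simp add: DERIV_pow)
    from has_vector_derivative_window[OF bounded_bilinear_scaleR \<tau> this _ cont t]
    show ?thesis
      unfolding y_def z_def e_def by (simp add: continuous_intros)
  qed
  have h: "((\<lambda>\<theta>. f \<theta> *\<^sub>R ?\<psi> \<theta>) has_integral integral {-\<tau>..0} (\<lambda>\<theta>. f \<theta> *\<^sub>R ?\<psi> \<theta>)) {-\<tau>..0}"
    if "continuous_on {-\<tau>..0} f" for f :: "real \<Rightarrow> real"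
    by (intro integrable_integral integrable_continuous_interval continuous_on_scaleR that \<psi>)
  have hy: "((\<lambda>\<theta>. \<theta> ^ a *\<^sub>R ?\<psi> \<theta>) has_integral y a t) {-\<tau>..0}" for a
    unfolding y_def by (intro h continuous_intros)
  have hz: "((\<lambda>\<theta>. (real a * \<theta> ^ (a - 1)) *\<^sub>R ?\<psi> \<theta>) has_integral z a) {-\<tau>..0}" for a
    unfolding z_def by (intro h continuous_intros)
  have hp: "((\<lambda>\<theta>. pmat p \<theta> *v ?\<psi> \<theta>) has_integral integral {-\<tau>..0} (\<lambda>\<theta>. pmat p \<theta> *v ?\<psi> \<theta>)) {-\<tau>..0}"
    for p :: "real poly^'n^'n"
    by (intro integrable_integral integrable_continuous_interval matvec.continuous_on \<psi> continuous_on_pmat)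
  \<comment> \<open>The double integral of \<open>\<partial>\<^sub>\<theta>R + \<partial>\<^sub>\<omega>R\<close>.\<close>
  define \<kappa> where "\<kappa> = (\<Sum>a\<le>m. \<Sum>b\<le>m. z a \<bullet> (C a b *v y b t)) + (\<Sum>a\<le>m. \<Sum>b\<le>m. y a t \<bullet> (C a b *v z b))"
  have vd1: "vector_derivative (\<lambda>s. R s \<omega>) (at \<theta>) =
      (\<Sum>a\<le>m. \<Sum>b\<le>m. ((real a * \<theta> ^ (a - 1)) * \<omega> ^ b) *\<^sub>R C a b)" for \<theta> \<omega>
    unfolding R
    by (intro vector_derivative_at has_vector_derivative_sum)
      (auto intro!: derivative_eq_intros)
  have vd2: "vector_derivative (\<lambda>s. R \<theta> s) (at \<omega>) =
      (\<Sum>a\<le>m. \<Sum>b\<le>m. (\<theta> ^ a * (real b * \<omega> ^ (b - 1))) *\<^sub>R C a b)" for \<theta> \<omega>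
    unfolding R
    by (intro vector_derivative_at has_vector_derivative_sum)
      (auto intro!: derivative_eq_intros)
  \<comment> \<open>The value of the form of \<open>M\<close> read off from its definition; it is compared below with the nonnegative value given by the coefficients of \<open>M\<close> as an element of \<open>G2\<close>.\<close>
  have M_form: "has_kernel_form \<tau> ?\<psi> (M_kernel (pmat A) (pmat q) R) (\<kappa> - \<alpha> \<bullet> iq t - iq t \<bullet> \<alpha>)"
    unfolding M_kernel_def vd1 vd2 \<kappa>_def \<alpha>_def iq_def
    by (intro has_kernel_form_diff has_kernel_form_add has_kernel_form_sum finite_atMost
        has_kernel_form_scalars has_kernel_form_separable hy hz hp)
  have M_nonneg: "0 \<le> \<kappa> - \<alpha> \<bullet> iq t - iq t \<bullet> \<alpha>"
  proof -
    obtain C' where C': "\<And>\<theta> \<omega>. M_kernel (pmat A) (pmat q) R \<theta> \<omega> =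
        (\<Sum>a\<le>d div 2. \<Sum>b\<le>d div 2. (\<theta> ^ a * \<omega> ^ b) *\<^sub>R C' a b)"
      and "\<And>a b. a \<le> d div 2 \<Longrightarrow> b \<le> d div 2 \<Longrightarrow> transpose (C' a b) = C' b a"
      and pos: "\<And>y. 0 \<le> (\<Sum>a\<le>d div 2. \<Sum>b\<le>d div 2. y a \<bullet> (C' a b *v y b))"
      by (rule G2_coefficients[OF M]) (rule that; assumption)
    have "has_kernel_form \<tau> ?\<psi> (M_kernel (pmat A) (pmat q) R)
        (\<Sum>a\<le>d div 2. \<Sum>b\<le>d div 2. y a t \<bullet> (C' a b *v y b t))"
      unfolding C'
      by (intro has_kernel_form_sum finite_atMost has_kernel_form_scalars hy)
    from has_kernel_form_unique[OF M_form this] show ?thesis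
      using pos[of "\<lambda>a. y a t"] by simp
  qed
  \<comment> \<open>Symmetry of the kernel \<open>R\<close>, used to merge the boundary terms in \<open>\<theta>\<close> and in \<open>\<omega>\<close>.\<close>
  have sym: "(\<Sum>a\<le>m. \<Sum>b\<le>m. f a \<bullet> (C a b *v g b)) = (\<Sum>a\<le>m. \<Sum>b\<le>m. g a \<bullet> (C a b *v f b))" for f g
  proof -
    have "(\<Sum>a\<le>m. \<Sum>b\<le>m. f a \<bullet> (C a b *v g b)) = (\<Sum>a\<le>m. \<Sum>b\<le>m. f a \<bullet> (transpose (C b a) *v g b))"
      by (intro sum.cong refl) (simp add: C)
    also have "\<dots> = (\<Sum>a\<le>m. \<Sum>b\<le>m. g b \<bullet> (C b a *v f a))"
      by (simp add: inner_transpose_mult inner_commute)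
    also have "\<dots> = (\<Sum>b\<le>m. \<Sum>a\<le>m. g b \<bullet> (C b a *v f a))"
      by (rule sum.swap)
    finally show ?thesis .
  qed
  have V: "lyapunov \<tau> P (pmat q) (pmat s) m C (\<lambda>\<theta>. x (t + \<theta>)) =
      x t \<bullet> (P *v x t) + 2 * (x t \<bullet> iq t) + js t + (\<Sum>a\<le>m. \<Sum>b\<le>m. y a t \<bullet> (C a b *v y b t))" for t
    by (simp add: lyapunov_def iq_def js_def y_def)
  define D where "D = (?x' \<bullet> (P *v x t) + x t \<bullet> (P *v ?x')) + 2 * (?x' \<bullet> iq t + x t \<bullet> iq') + js'
     + (\<Sum>a\<le>m. \<Sum>b\<le>m. (e a - z a) \<bullet> (C a b *v y b t) + y a t \<bullet> (C a b *v (e b - z b)))"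
  have "((\<lambda>t. lyapunov \<tau> P (pmat q) (pmat s) m C (\<lambda>\<theta>. x (t + \<theta>))) has_real_derivative D)
           (at t within {0..})"
    unfolding V D_def
    by (intro DERIV_add DERIV_cmult DERIV_sum has_derivative_inner_real
        has_vector_derivative_matvec x d_iq d_js d_y)
  moreover have "D \<le> - \<eta> * (x t \<bullet> x t)"
  proof -
    have "(\<Sum>a\<le>m. \<Sum>b\<le>m. (e a - z a) \<bullet> (C a b *v y b t) + y a t \<bullet> (C a b *v (e b - z b))) =
       2 * (\<Sum>a\<le>m. \<Sum>b\<le>m. e a \<bullet> (C a b *v y b t)) - \<kappa>"
      using sym[of "\<lambda>a. y a t" e]
      by (simp add: \<kappa>_def inner_diff_left inner_diff_right matvec.diff_right sum.distrib sum_subtractf)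
    moreover have "2 * (?x' \<bullet> (P *v x t)) + 2 * ((A\<^sub>0 *v x t) \<bullet> iq t + x t \<bullet> iq') + js'
       + 2 * (\<Sum>a\<le>m. \<Sum>b\<le>m. e a \<bullet> (C a b *v y b t)) \<le> - \<eta> * (x t \<bullet> x t)"
      using G3_dissipation[OF \<tau> \<eta> G3 R P \<psi> hy, of "x t" "x (t - \<tau>)"]
      unfolding \<alpha>_def iq_def iq'_def js'_def e_def .
    ultimately show ?thesis
      using M_nonneg unfolding D_def inner_symmetric_matrix[OF P, of "x t"]
      by (simp add: inner_add_left inner_commute algebra_simps)
  qed
  ultimately show ?thesis by blast
qed

section \<open>Existence of solutions\<close>

lemma dde_rhs_bound:
  fixes A\<^sub>0 :: "real^'n^'n"
  assumes \<tau>: "0 \<le> \<tau>" and F: "continuous_on {-\<tau>..0} F"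
  obtains c where "0 \<le> c"
    "\<And>(x :: real \<Rightarrow> real^'n) t K. continuous_on {-\<tau>..0} (\<lambda>\<theta>. x (t + \<theta>)) \<Longrightarrow>
       \<forall>\<theta>\<in>{-\<tau>..0}. norm (x (t + \<theta>)) \<le> K \<Longrightarrow>
       norm (A\<^sub>0 *v x t + integral {-\<tau>..0} (\<lambda>\<theta>. F \<theta> *v x (t + \<theta>))) \<le> c * K"
proof -
  obtain k where k: "0 \<le> k" "\<And>(B::real^'n^'n) v. norm (B *v v) \<le> norm B * norm v * k"
    using norm_matvec_le_bound by blast
  obtain c where c: "0 \<le> c" "\<And>(\<psi> :: real \<Rightarrow> real^'n) K. continuous_on {-\<tau>..0} \<psi> \<Longrightarrow>
      \<forall>\<theta>\<in>{-\<tau>..0}. norm (\<psi> \<theta>) \<le> K \<Longrightarrow>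
       norm (integral {-\<tau>..0} (\<lambda>\<theta>. F \<theta> *v \<psi> \<theta>)) \<le> c * K"
    using norm_integral_kernel_le[OF \<tau> F] by blast
  show ?thesis
  proof (rule that[of "norm A\<^sub>0 * k + c"])
    show "0 \<le> norm A\<^sub>0 * k + c" using k c by simp
    fix x :: "real \<Rightarrow> real^'n" and t K
    assume x: "continuous_on {-\<tau>..0} (\<lambda>\<theta>. x (t + \<theta>))"
      and K: "\<forall>\<theta>\<in>{-\<tau>..0}. norm (x (t + \<theta>)) \<le> K"
    have "norm (x t) \<le> K" using K[rule_format, of 0] \<tau> by simp
    then have "norm A\<^sub>0 * norm (x t) * k \<le> norm A\<^sub>0 * K * k"
      using k(1) by (intro mult_right_mono mult_left_mono) auto
    then have "norm (A\<^sub>0 *v x t) \<le> norm A\<^sub>0 * k * K"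
      using k(2)[of A\<^sub>0 "x t"] by (simp add: mult_ac)
    moreover have "norm (integral {-\<tau>..0} (\<lambda>\<theta>. F \<theta> *v x (t + \<theta>))) \<le> c * K"
      by (rule c(2)[OF x K])
    ultimately show "norm (A\<^sub>0 *v x t + integral {-\<tau>..0} (\<lambda>\<theta>. F \<theta> *v x (t + \<theta>)))
        \<le> (norm A\<^sub>0 * k + c) * K"
      by (simp add: distrib_right norm_triangle_mono)
  qed
qed

text \<open>
  Banach's fixed point theorem for the integrated equation on bounded continuous functions.
  A function \<open>u\<close> in this space stands for \<open>x(t) = exp(l max(t,0)) u(t)\<close>; with \<open>l > 2c\<close>, where \<open>c\<close>
  bounds the right-hand side, the integral operator contracts by \<open>1/2\<close> on the whole time axis,
  so that no continuation from small intervals is necessary. The initial function is extended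
  by constants, and \<open>max t 0\<close> as upper limit of the integral makes one formula valid on both
  sides of \<open>0\<close>.
\<close>

lemma dde_solution_exists:
  fixes A\<^sub>0 :: "real^'n^'n" and F :: "real \<Rightarrow> real^'n^'n"
  assumes \<tau>: "0 < \<tau>" and F: "continuous_on {-\<tau>..0} F" and \<phi>: "continuous_on {-\<tau>..0} \<phi>"
  shows "\<exists>x. is_solution \<tau> A\<^sub>0 F \<phi> x"
proof -
  define L where "L x t = A\<^sub>0 *v x t + integral {-\<tau>..0} (\<lambda>\<theta>. F \<theta> *v x (t + \<theta>))"
    for x :: "real \<Rightarrow> real^'n" and t
  obtain c where c: "0 \<le> c" "\<And>x t K. continuous_on {-\<tau>..0} (\<lambda>\<theta>. x (t + \<theta>)) \<Longrightarrow>
       \<forall>\<theta>\<in>{-\<tau>..0}. norm (x (t + \<theta>)) \<le> K \<Longrightarrow> norm (L x t) \<le> c * K"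
    by (rule dde_rhs_bound[OF less_imp_le[OF \<tau>] F, where A\<^sub>0 = A\<^sub>0, folded L_def]) (rule that; assumption)
  define l where "l = 2 * c + 1"
  have l: "0 < l" "c / l \<le> 1 / 2"
    using c(1) by (auto simp: l_def divide_simps)
  define X where "X u t = exp (l * max t 0) *\<^sub>R u t" for u :: "real \<Rightarrow> real^'n" and t
  have X_cont: "continuous_on U (X u)" if "continuous_on UNIV u" for u U
    unfolding X_def by (intro continuous_intros continuous_on_subset[OF that]) auto
  have shift: "continuous_on {-\<tau>..0} (\<lambda>\<theta>. x (t + \<theta>))" if "continuous_on UNIV x"
    for x :: "real \<Rightarrow> real^'n" and t
    by (intro continuous_on_compose2[OF that]) (auto intro!: continuous_on_add)
  have L_cont: "continuous_on U (L x)" if "continuous_on UNIV x" for x U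
  proof -
    have "continuous_on (U \<times> cbox (-\<tau>) 0) (\<lambda>z. F (snd z) *v x (fst z + snd z))"
      by (intro matvec.continuous_on continuous_on_compose2[OF F] continuous_on_compose2[OF that])
        (auto intro!: continuous_on_add continuous_on_fst continuous_on_snd)
    then have "continuous_on U (\<lambda>t. integral (cbox (-\<tau>) 0) (\<lambda>\<theta>. F \<theta> *v x (t + \<theta>)))"
      by (intro integral_continuous_on_param) (simp add: case_prod_unfold)
    then show ?thesis
      unfolding L_def
      by (intro continuous_on_add matvec.continuous_on continuous_on_const
          continuous_on_subset[OF that]) auto
  qed
  have L_diff: "L (\<lambda>t. x t - y t) t = L x t - L y t" if "continuous_on UNIV x" "continuous_on UNIV y"
    for x y t
  proof -
    have "(\<lambda>\<theta>. F \<theta> *v x (t + \<theta>)) integrable_on {-\<tau>..0}"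
      "(\<lambda>\<theta>. F \<theta> *v y (t + \<theta>)) integrable_on {-\<tau>..0}"
      by (intro integrable_continuous_interval matvec.continuous_on F shift that)+
    then show ?thesis
      unfolding L_def by (simp add: matvec.diff_right integral_diff)
  qed
  define I where "I u t = integral {0..max t 0} (L (X u))" for u t
  have I_bound: "norm (I u t) \<le> exp (l * max t 0) * (N / 2)"
    if u: "continuous_on UNIV u" and N: "\<And>t. norm (u t) \<le> N" for u N t
  proof -
    let ?T = "max t 0"
    have N0: "0 \<le> N" using N[of 0] norm_ge_zero order_trans by blast
    have bound: "norm (L (X u) s) \<le> c * (exp (l * s) * N)" if "s \<in> {0..?T}" for s
    proof (rule c(2))
      show "\<forall>\<theta>\<in>{-\<tau>..0}. norm (X u (s + \<theta>)) \<le> exp (l * s) * N"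
      proof
        fix \<theta> assume "\<theta> \<in> {-\<tau>..0}"
        then have "exp (l * max (s + \<theta>) 0) \<le> exp (l * s)" using that l(1) by auto
        then show "norm (X u (s + \<theta>)) \<le> exp (l * s) * N"
          unfolding X_def using N N0 by (auto intro!: mult_mono)
      qed
    qed (intro shift X_cont u)
    have int: "((\<lambda>s. c * (exp (l * s) * N)) has_integral
        c * N / l * exp (l * ?T) - c * N / l * exp (l * 0)) {0..?T}"
      using l(1)
      by (intro fundamental_theorem_of_calculus)
        (auto intro!: derivative_eq_intros simp: has_real_derivative_iff_has_vector_derivative[symmetric])
    have "norm (I u t) \<le> integral {0..?T} (\<lambda>s. c * (exp (l * s) * N))"
      unfolding I_def
      by (intro integral_norm_bound_integral bound has_integral_integrable[OF int]
          integrable_continuous_interval L_cont X_cont u)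
    also have "\<dots> = c * N / l * exp (l * ?T) - c * N / l"
      using integral_unique[OF int] by simp
    also have "\<dots> \<le> c / l * (N * exp (l * ?T))"
      using c(1) N0 l(1) by (simp add: mult.assoc)
    also have "\<dots> \<le> 1 / 2 * (N * exp (l * ?T))"
      using l(2) N0 by (intro mult_right_mono) auto
    finally show ?thesis by (simp add: mult_ac)
  qed
  have I_deriv: "((\<lambda>t. integral {0..t} (L (X u))) has_vector_derivative L (X u) t) (at t within {0..})"
    if "continuous_on UNIV u" "0 \<le> t" for u t
    by (intro integral_has_vector_derivative_ray L_cont X_cont that)
  have I_cont: "continuous_on UNIV (I u)" if "continuous_on UNIV u" for u
  proof -
    have "continuous_on {0..} (\<lambda>t. integral {0..t} (L (X u)))"
      by (rule continuous_on_vector_derivative[OF I_deriv[OF that]]) simp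
    then show ?thesis
      unfolding I_def by (rule continuous_on_compose2) (auto intro!: continuous_intros)
  qed
  define \<phi>' where "\<phi>' t = \<phi> (max (-\<tau>) (min 0 t))" for t
  have \<phi>'_cont: "continuous_on UNIV \<phi>'"
    unfolding \<phi>'_def using \<tau>
    by (intro continuous_on_compose2[OF \<phi>]) (auto intro!: continuous_intros)
  define T where "T u t = exp (- l * max t 0) *\<^sub>R (\<phi>' t + I u t)" for u t
  obtain b where b: "0 \<le> b" "\<And>\<theta>. \<theta> \<in> {-\<tau>..0} \<Longrightarrow> norm (\<phi> \<theta>) \<le> b"
    using bounded_on_continuous[OF \<phi>] by blast
  have T_bcontfun: "T u \<in> bcontfun" if u: "continuous_on UNIV u" and N: "\<And>t. norm (u t) \<le> N" for u N
  proof (rule bcontfun_normI)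
    show "continuous_on UNIV (T u)"
      unfolding T_def by (intro continuous_intros \<phi>'_cont I_cont u)
    fix t
    have "norm (T u t) \<le> exp (- l * max t 0) * (norm (\<phi>' t) + norm (I u t))"
      unfolding T_def by (simp add: norm_triangle_ineq)
    also have "\<dots> \<le> exp (- l * max t 0) * norm (\<phi>' t) + exp (- l * max t 0) * (exp (l * max t 0) * (N / 2))"
      unfolding distrib_left by (intro add_left_mono mult_left_mono I_bound u N) simp
    also have "\<dots> \<le> 1 * b + N / 2"
      using b(2)[of "max (-\<tau>) (min 0 t)"] l(1) \<tau>
      by (intro add_mono mult_mono) (auto simp: \<phi>'_def mult.assoc[symmetric] mult_exp_exp)
    finally show "norm (T u t) \<le> 1 * b + N / 2" .
  qed
  have u_bd: "norm (apply_bcontfun u t) \<le> norm u" for u :: "real \<Rightarrow>\<^sub>C (real^'n)" and t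
    by (rule norm_bounded)
  define Tb where "Tb u = Bcontfun (T (apply_bcontfun u))" for u
  have Tb: "apply_bcontfun (Tb u) = T (apply_bcontfun u)" for u
    unfolding Tb_def by (rule Bcontfun_inverse) (rule T_bcontfun[OF _ u_bd], simp)
  have "dist (Tb u) (Tb v) \<le> 1 / 2 * dist u v" for u v
  proof (rule dist_bound)
    fix t
    have X_diff: "X (\<lambda>t. apply_bcontfun u t - apply_bcontfun v t) = (\<lambda>t. X u t - X v t)"
      by (simp add: X_def fun_eq_iff scaleR_diff_right)
    have I_diff: "I u t - I v t = I (\<lambda>t. apply_bcontfun u t - apply_bcontfun v t) t"
    proof -
      have "I (\<lambda>t. apply_bcontfun u t - apply_bcontfun v t) t =
          integral {0..max t 0} (\<lambda>s. L (X u) s - L (X v) s)"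
        unfolding I_def X_diff
        by (rule arg_cong[where f = "integral _"], rule ext, rule L_diff) (intro X_cont; simp)+
      also have "\<dots> = I u t - I v t"
        unfolding I_def
        by (intro integral_diff integrable_continuous_interval L_cont X_cont) auto
      finally show ?thesis ..
    qed
    have "dist (Tb u t) (Tb v t) = exp (- l * max t 0) * norm (I u t - I v t)"
      by (simp add: Tb T_def dist_norm flip: scaleR_diff_right)
    also have "\<dots> \<le> exp (- l * max t 0) * (exp (l * max t 0) * (dist u v / 2))"
      unfolding I_diff
      by (intro mult_left_mono I_bound continuous_on_diff)
        (auto simp: dist_norm[symmetric] dist_bounded)
    also have "\<dots> = 1 / 2 * dist u v"
      by (simp add: mult.assoc[symmetric] mult_exp_exp)
    finally show "dist (Tb u t) (Tb v t) \<le> 1 / 2 * dist u v" .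
  qed
  then obtain u where u: "Tb u = u"
    using banach_fix_type[of "1/2" Tb] by auto
  define x where "x = X u"
  have x_cont: "continuous_on UNIV x"
    unfolding x_def by (rule X_cont) simp
  have x_eq: "x t = \<phi>' t + integral {0..max t 0} (L x)" for t
  proof -
    have "x t = exp (l * max t 0) *\<^sub>R T u t"
      unfolding x_def X_def using Tb[of u] u by simp
    then show ?thesis
      by (simp add: T_def I_def x_def mult_exp_exp)
  qed
  let ?x = "restrict x {-\<tau>..}"
  have "is_solution \<tau> A\<^sub>0 F \<phi> ?x"
    unfolding is_solution_def
  proof (intro conjI ballI allI impI)
    show "continuous_on {-\<tau>..} ?x"
      by (rule continuous_on_eq[OF continuous_on_subset[OF x_cont]]) auto
    show "?x \<theta> = \<phi> \<theta>" if "\<theta> \<in> {-\<tau>..0}" for \<theta>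
      using that \<tau> by (simp add: x_eq \<phi>'_def max_absorb2 min_absorb2)
    fix t :: real assume t: "0 \<le> t"
    have "integral {-\<tau>..0} (\<lambda>\<theta>. F \<theta> *v ?x (t + \<theta>)) = integral {-\<tau>..0} (\<lambda>\<theta>. F \<theta> *v x (t + \<theta>))"
      using t by (intro integral_cong) auto
    then have rhs: "A\<^sub>0 *v ?x t + integral {-\<tau>..0} (\<lambda>\<theta>. F \<theta> *v ?x (t + \<theta>)) = 0 + L x t"
      using t \<tau> by (simp add: L_def)
    have d: "((\<lambda>t. \<phi> 0 + integral {0..t} (L x)) has_vector_derivative 0 + L x t) (at t within {0..})"
      unfolding x_def
      by (intro has_vector_derivative_add has_vector_derivative_const I_deriv t) simp
    show "(?x has_vector_derivative A\<^sub>0 *v ?x t + integral {-\<tau>..0} (\<lambda>\<theta>. F \<theta> *v ?x (t + \<theta>)))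
        (at t within {0..})"
      unfolding rhs
      by (rule has_vector_derivative_transform[OF _ _ d]) (use t \<tau> in \<open>auto simp: x_eq[of s for s] \<phi>'_def\<close>)
  qed simp
  then show ?thesis by blast
qed

section \<open>Dissipation implies convergence\<close>

lemma dissipation_decrease:
  fixes V :: "real \<Rightarrow> real" and x :: "real \<Rightarrow> 'a::real_inner"
  assumes V: "\<And>t. 0 \<le> t \<Longrightarrow> \<exists>D. (V has_real_derivative D) (at t within {0..}) \<and> D \<le> - \<eta> * (x t \<bullet> x t)"
    and \<eta>: "0 \<le> \<eta>" and st: "0 \<le> s" "s \<le> t"
    and k: "\<And>r. s \<le> r \<Longrightarrow> r \<le> t \<Longrightarrow> k \<le> x r \<bullet> x r"
  shows "V t \<le> V s - \<eta> * k * (t - s)"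
proof -
  have "V t + \<eta> * k * t \<le> V s + \<eta> * k * s"
  proof (rule DERIV_nonpos_imp_decreasing_open[OF st(2)])
    fix r assume r: "s < r" "r < t"
    obtain D where D: "(V has_real_derivative D) (at r within {0..})" "D \<le> - \<eta> * (x r \<bullet> x r)"
      using V[of r] r st by auto
    have "at r within {0..} = at r"
      using r st by (intro at_within_interior) simp
    with D(1) have "((\<lambda>t. V t + \<eta> * k * t) has_real_derivative D + \<eta> * k) (at r)"
      by (auto intro!: derivative_eq_intros)
    moreover have "\<eta> * k \<le> \<eta> * (x r \<bullet> x r)"
      using k[of r] r \<eta> by (intro mult_left_mono) auto
    ultimately show "\<exists>y. ((\<lambda>t. V t + \<eta> * k * t) has_real_derivative y) (at r) \<and> y \<le> 0"
      using D(2) by (intro exI[of _ "D + \<eta> * k"]) auto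
  next
    have "continuous_on {0..} V"
      using V by (meson DERIV_continuous atLeast_iff continuous_on_eq_continuous_within)
    then show "continuous_on {s..t} (\<lambda>t. V t + \<eta> * k * t)"
      using st by (intro continuous_intros) (auto elim: continuous_on_subset)
  qed
  then show ?thesis by (simp add: algebra_simps)
qed

text \<open>
  If \<open>x\<close> did not tend to zero, its norm would reach some \<open>\<epsilon>\<close> at arbitrarily late times. By the
  Lipschitz bound it stays above \<open>\<epsilon>/2\<close> for a fixed time \<open>h\<close> after each of them, so \<open>V\<close> loses a
  fixed amount infinitely often and cannot stay nonnegative.
\<close>

lemma dissipation_imp_tendsto_zero:
  fixes V :: "real \<Rightarrow> real" and x :: "real \<Rightarrow> 'a::real_inner"
  assumes V: "\<And>t. 0 \<le> t \<Longrightarrow> \<exists>D. (V has_real_derivative D) (at t within {0..}) \<and> D \<le> - \<eta> * (x t \<bullet> x t)"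
    and \<eta>: "0 < \<eta>" and V_nonneg: "\<And>t. 0 \<le> t \<Longrightarrow> 0 \<le> V t"
    and L: "0 \<le> L" "\<And>s t. 0 \<le> s \<Longrightarrow> s \<le> t \<Longrightarrow> norm (x t - x s) \<le> L * (t - s)"
  shows "(x \<longlongrightarrow> 0) at_top"
proof (rule ccontr)
  assume "\<not> (x \<longlongrightarrow> 0) at_top"
  then obtain \<epsilon> where \<epsilon>: "0 < \<epsilon>" and "\<not> (\<forall>\<^sub>F t in at_top. norm (x t) < \<epsilon>)"
    by (auto simp: tendsto_iff)
  then have often: "\<exists>t\<ge>T. \<epsilon> \<le> norm (x t)" for T
    by (auto simp: eventually_at_top_linorder not_less)
  define h where "h = \<epsilon> / (2 * (L + 1))"
  have h: "0 < h" "L * h \<le> \<epsilon> / 2"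
    using L(1) \<epsilon> by (auto simp: h_def divide_simps algebra_simps)
  define \<kappa> where "\<kappa> = \<eta> * (\<epsilon> / 2)\<^sup>2 * h"
  have \<kappa>: "0 < \<kappa>" using \<eta> \<epsilon> h by (simp add: \<kappa>_def)
  have "\<exists>t\<ge>0. V t \<le> V 0 - real n * \<kappa>" for n
  proof (induction n)
    case 0
    show ?case by auto
  next
    case (Suc n)
    then obtain t where t: "0 \<le> t" "V t \<le> V 0 - real n * \<kappa>" by blast
    obtain s where s: "t \<le> s" "\<epsilon> \<le> norm (x s)" using often by blast
    have "V s \<le> V t - \<eta> * 0 * (s - t)"
      by (rule dissipation_decrease[OF V]) (use \<eta> t s in auto)
    moreover have "V (s + h) \<le> V s - \<eta> * (\<epsilon> / 2)\<^sup>2 * (s + h - s)"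
    proof (rule dissipation_decrease[OF V])
      fix r assume r: "s \<le> r" "r \<le> s + h"
      have "norm (x r - x s) \<le> L * (r - s)" using r s t by (intro L) auto
      also have "\<dots> \<le> L * h" using r L(1) by (intro mult_left_mono) auto
      finally have "\<epsilon> / 2 \<le> norm (x r)"
        using h(2) s(2) norm_triangle_ineq2[of "x s" "x r"] by (simp add: norm_minus_commute)
      then have "(\<epsilon> / 2)\<^sup>2 \<le> (norm (x r))\<^sup>2" using \<epsilon> by (intro power_mono) auto
      then show "(\<epsilon> / 2)\<^sup>2 \<le> x r \<bullet> x r" by (simp add: power2_norm_eq_inner)
    qed (use \<eta> s t h in auto)
    ultimately show ?case
      using t s h by (intro exI[of _ "s + h"]) (auto simp: \<kappa>_def algebra_simps)
  qed
  moreover obtain n where "V 0 < real n * \<kappa>"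
    using \<kappa> reals_Archimedean3 by blast
  ultimately show False
    using V_nonneg by (metis diff_less_0_iff_less leD le_less_trans)
qed


lemma vec_derivative_lipschitz:
  fixes x :: "real \<Rightarrow> 'a::banach"
  assumes x: "\<And>t. 0 \<le> t \<Longrightarrow> (x has_vector_derivative x' t) (at t within {0..})"
    and L: "0 \<le> L" "\<And>t. 0 \<le> t \<Longrightarrow> norm (x' t) \<le> L" and st: "0 \<le> s" "s \<le> t"
  shows "norm (x t - x s) \<le> L * (t - s)"
proof -
  have "(x' has_integral x t - x s) {s..t}"
    using st by (intro fundamental_theorem_of_calculus)
      (auto intro!: has_vector_derivative_within_subset[OF x])
  from has_integral_bound_real[OF L(1) finite.emptyI this] show ?thesis
    using L(2) st by auto
qed

section \<open>The stability theorem\<close>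

theorem mainTheorem7:
  fixes \<tau> :: real and d :: nat
    and A\<^sub>0 :: "real^'n^'n" and A :: "real poly^'n^'n"
    and \<eta> :: real and P :: "real^'n^'n"
    and Q S :: "real \<Rightarrow> real^'n^'n"
    and R :: "real \<Rightarrow> real \<Rightarrow> real^'n^'n"
  assumes "\<tau> > 0" and "even d"
    and "\<eta> > 0"
    and "sym_matrix P"
    and "\<And>\<theta>. sym_matrix (S \<theta>)"
    and "\<And>\<theta> \<omega>. R \<theta> \<omega> = transpose (R \<omega> \<theta>)"
    and "(\<lambda>\<theta>. block_matrix (P - \<eta> *\<^sub>R mat 1) (\<tau> *\<^sub>R Q \<theta>)
                           (\<tau> *\<^sub>R transpose (Q \<theta>)) (\<tau> *\<^sub>R S \<theta>)) \<in> G1 \<tau> d"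
    and "(\<lambda>\<theta>. - D_matrix \<tau> \<eta> A\<^sub>0 (pmat A) P Q S R \<theta>) \<in> G3 \<tau> d"
    and "R \<in> G2 d"
    and "M_kernel (pmat A) Q R \<in> G2 d"
  shows "asymptotically_stable \<tau> (solution_map \<tau> A\<^sub>0 (pmat A))"
proof -
  note \<tau> = assms(1) and \<eta> = assms(3) and P = assms(4)
  note G1 = assms(7) and G3 = assms(8) and M = assms(10)
  \<comment> \<open>Membership in \<open>G1\<close> makes \<open>Q\<close> and \<open>S\<close> polynomial, hence differentiable: they are blocks of a polynomial matrix, up to the factor \<open>\<tau>\<close>.\<close>
  obtain q s where Q: "Q = pmat q" and S: "S = pmat s"
  proof -
    obtain p where p: "(\<lambda>\<theta>. block_matrix (P - \<eta> *\<^sub>R mat 1) (\<tau> *\<^sub>R Q \<theta>)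
        (\<tau> *\<^sub>R transpose (Q \<theta>)) (\<tau> *\<^sub>R S \<theta>)) = pmat p"
      using G1 unfolding G1_def sym_poly_matrices_def by blast
    have pe: "poly (p $ Inl i $ Inr j) \<theta> = \<tau> * Q \<theta> $ i $ j" "poly (p $ Inr i $ Inr j) \<theta> = \<tau> * S \<theta> $ i $ j"
      for \<theta> i j
      using fun_cong[OF p, of \<theta>] by (auto simp: vec_eq_iff block_matrix_def pmat_def split: sum.splits)
    then have "Q = pmat (\<chi> i j. smult (1 / \<tau>) (p $ Inl i $ Inr j))"
      "S = pmat (\<chi> i j. smult (1 / \<tau>) (p $ Inr i $ Inr j))"
      using \<tau> by (auto simp: fun_eq_iff vec_eq_iff pmat_def pe)
    then show ?thesis by (rule that)
  qed
  define m where "m = d div 2"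
  obtain C where R: "\<And>\<theta> \<omega>. R \<theta> \<omega> = (\<Sum>a\<le>m. \<Sum>b\<le>m. (\<theta> ^ a * \<omega> ^ b) *\<^sub>R C a b)"
    and C_sym: "\<And>a b. a \<le> m \<Longrightarrow> b \<le> m \<Longrightarrow> transpose (C a b) = C b a"
    and C_pos: "\<And>y. 0 \<le> (\<Sum>a\<le>m. \<Sum>b\<le>m. y a \<bullet> (C a b *v y b))"
    by (rule G2_coefficients[OF assms(9), folded m_def]) (rule that; assumption)
  let ?rhs = "\<lambda>x t. A\<^sub>0 *v x t + integral {-\<tau>..0} (\<lambda>\<theta>. pmat A \<theta> *v x (t + \<theta>))"
  define trajectory where "trajectory x \<longleftrightarrow> continuous_on {-\<tau>..} x \<and>
    (\<forall>t\<ge>0. (x has_vector_derivative ?rhs x t) (at t within {0..}))" for x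
  define V where "V x t = lyapunov \<tau> P Q S m C (\<lambda>\<theta>. x (t + \<theta>))" for x t
  have hist: "continuous_on {-\<tau>..0} (\<lambda>\<theta>. x (t + \<theta>))" if "trajectory x" "0 \<le> t" for x :: "real \<Rightarrow> real^'n" and t
    using that unfolding trajectory_def
    by (auto intro!: continuous_on_compose2[of "{-\<tau>..}" x] continuous_on_add)
  have V_deriv: "\<exists>D. (V x has_real_derivative D) (at t within {0..}) \<and> D \<le> - \<eta> * (x t \<bullet> x t)"
    if "trajectory x" "0 \<le> t" for x t
    using that lyapunov_derivative[OF \<tau> less_imp_le[OF \<eta>] P G3[unfolded Q S] R C_sym M[unfolded Q]]
    unfolding V_def Q S trajectory_def by blast
  have V_lower: "\<eta> * (x t \<bullet> x t) \<le> V x t" if "trajectory x" "0 \<le> t" for x t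
    using lyapunov_lower_bound[OF \<tau> G1 _ _ C_pos hist[OF that]]
    by (simp add: V_def Q S continuous_on_pmat)
  obtain c where c: "0 \<le> c" "\<And>\<psi> K. continuous_on {-\<tau>..0} \<psi> \<Longrightarrow> \<forall>\<theta>\<in>{-\<tau>..0}. norm (\<psi> \<theta>) \<le> K \<Longrightarrow>
       lyapunov \<tau> P Q S m C \<psi> \<le> c * K\<^sup>2"
    by (rule lyapunov_upper_bound[OF \<tau> continuous_on_pmat continuous_on_pmat, of P q s m C, folded Q S])
      (rule that; assumption)
  \<comment> \<open>From \<open>\<eta> |x(t)|\<^sup>2 \<le> V(t) \<le> V(0) \<le> c K\<^sup>2\<close>; the maximum with 1 covers the times in \<open>[-\<tau>, 0]\<close>.\<close>
  define \<gamma> where "\<gamma> = max 1 (sqrt (c / \<eta>))"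
  have \<gamma>: "1 \<le> \<gamma>" by (simp add: \<gamma>_def)
  have bound: "norm (x t) \<le> \<gamma> * K"
    if x: "trajectory x" and K: "\<And>\<theta>. \<theta> \<in> {-\<tau>..0} \<Longrightarrow> norm (x \<theta>) \<le> K" and t: "-\<tau> \<le> t" for x K t
  proof -
    have K0: "0 \<le> K" using order_trans[OF norm_ge_zero K[of 0]] \<tau> by simp
    show ?thesis
    proof (cases "0 \<le> t")
      case True
      have "\<eta> * (norm (x t))\<^sup>2 \<le> V x t"
        using V_lower[OF x True] by (simp add: power2_norm_eq_inner)
      also have "V x t \<le> V x 0 - \<eta> * 0 * (t - 0)"
        by (rule dissipation_decrease[OF V_deriv[OF x]]) (use \<eta> True in auto)
      also have "\<dots> \<le> c * K\<^sup>2"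
        using c(2)[OF hist[OF x order_refl], of K] K by (simp add: V_def)
      finally have "(norm (x t))\<^sup>2 \<le> c / \<eta> * K\<^sup>2"
        using \<eta> by (simp add: field_simps)
      then have "norm (x t) \<le> sqrt (c / \<eta> * K\<^sup>2)"
        by (rule real_le_rsqrt)
      also have "\<dots> = sqrt (c / \<eta>) * K"
        unfolding real_sqrt_mult using K0 by simp
      also have "\<dots> \<le> \<gamma> * K"
        using K0 by (intro mult_right_mono) (auto simp: \<gamma>_def)
      finally show ?thesis .
    next
      case False
      then have "norm (x t) \<le> 1 * K" using K[of t] t by simp
      also have "\<dots> \<le> \<gamma> * K" using \<gamma> K0 by (intro mult_right_mono) auto
      finally show ?thesis .
    qed
  qed
  have sol_traj: "trajectory x" if "is_solution \<tau> A\<^sub>0 (pmat A) \<phi> x" for \<phi> x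
    using that by (simp add: is_solution_def trajectory_def)
  \<comment> \<open>The difference of two solutions is a trajectory with zero history, to which the a priori bound applies with \<open>K = 0\<close>.\<close>
  have unique: "x = y" if x: "is_solution \<tau> A\<^sub>0 (pmat A) \<phi> x" and y: "is_solution \<tau> A\<^sub>0 (pmat A) \<phi> y"
    for \<phi> x y
  proof -
    let ?z = "\<lambda>t. x t - y t"
    note tx = sol_traj[OF x] and ty = sol_traj[OF y]
    have rhs: "?rhs ?z t = ?rhs x t - ?rhs y t" if "0 \<le> t" for t
    proof -
      have "(\<lambda>\<theta>. pmat A \<theta> *v x (t + \<theta>)) integrable_on {-\<tau>..0}"
        "(\<lambda>\<theta>. pmat A \<theta> *v y (t + \<theta>)) integrable_on {-\<tau>..0}"
        by (intro integrable_continuous_interval matvec.continuous_on continuous_on_pmat hist tx ty that)+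
      then show ?thesis
        by (simp add: matvec.diff_right integral_diff)
    qed
    have "trajectory ?z"
      unfolding trajectory_def
    proof (intro conjI allI impI)
      show "continuous_on {-\<tau>..} ?z"
        using tx ty by (intro continuous_on_diff) (auto simp: trajectory_def)
      show "(?z has_vector_derivative ?rhs ?z t) (at t within {0..})" if "0 \<le> t" for t
        unfolding rhs[OF that]
        using tx ty that by (intro has_vector_derivative_diff) (auto simp: trajectory_def)
    qed
    from bound[OF this, of 0] have "x t = y t" if "-\<tau> \<le> t" for t
      using x y that by (auto simp: is_solution_def)
    then show "x = y"
      using x y by (intro extensionalityI[of _ "{-\<tau>..}"]) (auto simp: is_solution_def)
  qed
  let ?\<Gamma> = "solution_map \<tau> A\<^sub>0 (pmat A)"
  have sol: "is_solution \<tau> A\<^sub>0 (pmat A) \<phi> (?\<Gamma> \<phi>)" if \<phi>: "\<phi> \<in> C_space \<tau>" for \<phi>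
  proof -
    obtain x where "is_solution \<tau> A\<^sub>0 (pmat A) \<phi> x"
      using dde_solution_exists[OF \<tau> continuous_on_pmat] \<phi> unfolding C_space_def by blast
    from theI[of "is_solution \<tau> A\<^sub>0 (pmat A) \<phi>", OF this unique[OF _ this]] show ?thesis
      unfolding solution_map_def .
  qed
  have sol_bound: "norm (?\<Gamma> \<phi> t) \<le> \<gamma> * C_norm \<tau> \<phi>" if \<phi>: "\<phi> \<in> C_space \<tau>" and t: "-\<tau> \<le> t" for \<phi> t
  proof (rule bound[OF sol_traj[OF sol[OF \<phi>]] _ t])
    fix \<theta> assume \<theta>: "\<theta> \<in> {-\<tau>..0}"
    obtain b where "\<And>\<theta>. \<theta> \<in> {-\<tau>..0} \<Longrightarrow> norm (\<phi> \<theta>) \<le> b"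
      using bounded_on_continuous \<phi> unfolding C_space_def by blast
    then have "norm (\<phi> \<theta>) \<le> C_norm \<tau> \<phi>"
      unfolding C_norm_def by (intro cSUP_upper \<theta> bdd_aboveI2)
    then show "norm (?\<Gamma> \<phi> \<theta>) \<le> C_norm \<tau> \<phi>"
      using sol[OF \<phi>] \<theta> by (simp add: is_solution_def)
  qed
  show ?thesis
    unfolding asymptotically_stable_def
  proof (intro conjI ballI allI impI)
    show "bounded (?\<Gamma> \<phi> ` {-\<tau>..})" if "\<phi> \<in> C_space \<tau>" for \<phi>
      using sol_bound[OF that] by (auto intro!: boundedI)
  next
    fix \<epsilon> :: real assume \<epsilon>: "0 < \<epsilon>"
    have "(SUP t\<in>{-\<tau>..}. norm (?\<Gamma> \<phi> t)) < \<epsilon>"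
      if \<phi>: "\<phi> \<in> C_space \<tau>" "C_norm \<tau> \<phi> < \<epsilon> / (2 * \<gamma>)" for \<phi>
    proof -
      have "\<gamma> * C_norm \<tau> \<phi> \<le> \<epsilon> / 2"
        using \<phi>(2) \<gamma> by (simp add: field_simps)
      then have "norm (?\<Gamma> \<phi> t) \<le> \<epsilon> / 2" if "t \<in> {-\<tau>..}" for t
        using sol_bound[OF \<phi>(1), of t] that by simp
      then have "(SUP t\<in>{-\<tau>..}. norm (?\<Gamma> \<phi> t)) \<le> \<epsilon> / 2"
        by (intro cSUP_least) auto
      then show ?thesis using \<epsilon> by simp
    qed
    then show "\<exists>\<delta>>0. \<forall>\<phi>\<in>C_space \<tau>. C_norm \<tau> \<phi> < \<delta> \<longrightarrow> (SUP t\<in>{-\<tau>..}. norm (?\<Gamma> \<phi> t)) < \<epsilon>"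
      using \<epsilon> \<gamma> by (intro exI[of _ "\<epsilon> / (2 * \<gamma>)"]) auto
  next
    fix \<phi> :: "real \<Rightarrow> real^'n" assume \<phi>: "\<phi> \<in> C_space \<tau>"
    let ?x = "?\<Gamma> \<phi>"
    let ?K = "\<gamma> * C_norm \<tau> \<phi>"
    have x: "trajectory ?x" by (rule sol_traj[OF sol[OF \<phi>]])
    obtain L where L: "0 \<le> L" "\<And>(x :: real \<Rightarrow> real^'n) t K. continuous_on {-\<tau>..0} (\<lambda>\<theta>. x (t + \<theta>)) \<Longrightarrow>
       \<forall>\<theta>\<in>{-\<tau>..0}. norm (x (t + \<theta>)) \<le> K \<Longrightarrow> norm (?rhs x t) \<le> L * K"
      by (rule dde_rhs_bound[OF less_imp_le[OF \<tau>] continuous_on_pmat, where A\<^sub>0 = A\<^sub>0]) (rule that; assumption)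
    have K: "0 \<le> ?K"
      using sol_bound[OF \<phi>, of 0] \<tau> norm_ge_zero[of "?x 0"] by linarith
    have rhs_bound: "norm (?rhs ?x t) \<le> L * ?K" if "0 \<le> t" for t
      using that by (intro L(2) hist x ballI sol_bound[OF \<phi>]) auto
    show "(?x \<longlongrightarrow> 0) at_top"
    proof (rule dissipation_imp_tendsto_zero[OF V_deriv[OF x] \<eta>])
      show "0 \<le> V ?x t" if "0 \<le> t" for t
        using V_lower[OF x that] \<eta> by (smt (verit) inner_ge_zero mult_nonneg_nonneg)
      show "0 \<le> L * ?K" using L K by simp
      show "norm (?x t - ?x s) \<le> L * ?K * (t - s)" if "0 \<le> s" "s \<le> t" for s t
        by (rule vec_derivative_lipschitz[OF _ _ rhs_bound])
          (use x that L K in \<open>auto simp: trajectory_def\<close>)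
    qed
  qed
qed

end
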